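(* Let $p\in\mathcal{P}(\mathbb{R}^n)$ and let $\nu$ be a constant exponent with $2\le p^-$ and $2\le\nu\le2p^-$, and let $m>n$. Then there is a constant $C=C(m,p)>0$ such that for every $t>0$ and all $u,v\in L^{p(\cdot)}(\mathbb{R}^n)\cap L^\nu(\mathbb{R}^n)$, $$\|\eta_{t,m}*(uv)\|_{L^{p(\cdot)}(\mathbb{R}^n)\cap L^\nu(\mathbb{R}^n)}\le C\max\left(t^{-n\omega(t)},t^{-\frac n\nu}\right)\|u\|_{L^{p(\cdot)}(\mathbb{R}^n)\cap L^\nu(\mathbb{R}^n)}\|v\|_{L^{p(\cdot)}(\mathbb{R}^n)\cap L^\nu(\mathbb{R}^n)},$$ where $$\omega(t)=\begin{cases}\frac2{p^-}\left(1-\frac{\nu}{2p^+}\right), & 0<t\le1,\\ \frac2{p^+}\left(1-\frac{\nu}{2p^-}\right), & t>1.\end{cases}$$ Moreover, if $p\in\mathcal{P}^{\log}(\mathbb{R}^n)$ with $2\le p^-=p_\infty$, then there is a constant $C>0$ such that for every $t>0$ and all $u,v\in L^{p(\cdot)}(\mathbb{R}^n)$, $$\|\eta_{t,m}*(uv)\|_{L^{p(\cdot)}(\mathbb{R}^n)}\le C\,t^{-n\phi(t)}\|u\|_{L^{p(\cdot)}(\mathbb{R}^n)}\|v\|_{L^{p(\cdot)}(\mathbb{R}^n)},\qquad \phi(t)=\begin{cases}\frac2{p^-}-\frac1{p^+}, & 0<t\le1,\\ \frac1{p^+}, & t>1.\end{cases}$$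
   Context: $\mathcal{P}(\mathbb{R}^n)$ is the set of measurable functions $p:\mathbb{R}^n\to[1,\infty]$; $p^-$ and $p^+$ are the essential infimum and supremum of $p$; $\frac a\infty:=0$. The modular is $\varrho_{p(\cdot)}(f)=\int_{\mathbb{R}^n}\omega_{p(x)}(|f(x)|)\,dx$, with $\omega_p(t)=t^p$ if $p<\infty$, and $\omega_\infty(t)=0$ for $t\le1$, $\omega_\infty(t)=\infty$ for $t>1$ (this $\omega_p$ is unrelated to the function $\omega(t)$ of the claim). $L^{p(\cdot)}(\mathbb{R}^n)$ is the space of measurable $f$ with $\varrho_{p(\cdot)}(\lambda f)<\infty$ for some $\lambda>0$, normed by $\|f\|_{L^{p(\cdot)}}=\inf\{\lambda>0:\varrho_{p(\cdot)}(f/\lambda)\le1\}$. An intersection $X\cap Y$ carries the norm $\max\{\|f\|_X,\|f\|_Y\}$. A real function $g$ on $\mathbb{R}^n$ is globally log-Hölder continuous if there are $c>0$ and $g_\infty\in\mathbb{R}$ with $|g(x)-g(y)|\le \frac{c}{\log(e+1/|x-y|)}$ and $|g(x)-g_\infty|\le\frac{c}{\log(e+|x|)}$ for all $x,y$. $\mathcal{P}^{\log}(\mathbb{R}^n)$ is the set of $p\in\mathcal{P}(\mathbb{R}^n)$ with $1/p$ globally log-Hölder continuous, and $p_\infty\in[1,\infty]$ is defined by $\frac1{p_\infty}=\lim_{|x|\to\infty}\frac1{p(x)}$. $\eta_{t,m}(x):=t^{-n}(1+t^{-1}|x|)^{-m}$ for $x\in\mathbb{R}^n$, $t>0$, $m>0$.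 *)

theory Defs
  imports "HOL-Probability.Essential_Supremum"
begin

text \<open>
  Exponents take values in \<^typ>\<open>ennreal\<close>, where \<open>a / \<infinity> = 0\<close> holds for every \<open>a\<close>
  (including \<open>a = \<infinity>\<close>).
\<close>

definition var_exps :: "('a::euclidean_space \<Rightarrow> ennreal) set" where
  "var_exps = {p \<in> borel_measurable lebesgue. \<forall>x. 1 \<le> p x}"

definition p_minus :: "('a::euclidean_space \<Rightarrow> ennreal) \<Rightarrow> ennreal" where
  "p_minus p = Sup {z. AE x in lebesgue. z \<le> p x}"

definition p_plus :: "('a::euclidean_space \<Rightarrow> ennreal) \<Rightarrow> ennreal" where
  "p_plus p = esssup lebesgue p"

definition omega_mod :: "ennreal \<Rightarrow> real \<Rightarrow> ennreal" where
  "omega_mod q s =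
     (if q = \<infinity> then (if s \<le> 1 then 0 else \<infinity>) else ennreal (s powr enn2real q))"

definition modular ::
    "('a::euclidean_space \<Rightarrow> ennreal) \<Rightarrow> ('a \<Rightarrow> 'k::real_normed_vector) \<Rightarrow> ennreal" where
  "modular p f = (\<integral>\<^sup>+ x. omega_mod (p x) (norm (f x)) \<partial>lebesgue)"

definition Lp_space ::
    "('a::euclidean_space \<Rightarrow> ennreal) \<Rightarrow> ('a \<Rightarrow> 'k::real_normed_vector) set" where
  "Lp_space p =
     {f \<in> borel_measurable lebesgue. \<exists>s::real. s > 0 \<and> modular p (\<lambda>x. s *\<^sub>R f x) < \<infinity>}"

text \<open>
  Real-valued, hence only meaningful on \<open>Lp_space p\<close>: outside it the infimum may be taken over
  the empty set.
\<close>
definition Lp_norm ::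
    "('a::euclidean_space \<Rightarrow> ennreal) \<Rightarrow> ('a \<Rightarrow> 'k::real_normed_vector) \<Rightarrow> real" where
  "Lp_norm p f = Inf {s::real. s > 0 \<and> modular p (\<lambda>x. f x /\<^sub>R s) \<le> 1}"

definition Lp_inter_norm ::
    "('a::euclidean_space \<Rightarrow> ennreal) \<Rightarrow> ('a \<Rightarrow> ennreal) \<Rightarrow> ('a \<Rightarrow> 'k::real_normed_vector) \<Rightarrow> real"
  where "Lp_inter_norm p q f = max (Lp_norm p f) (Lp_norm q f)"

text \<open>
  For \<open>x = y\<close> the first bound reads \<open>0 \<le> c\<close> (as \<open>1 / 0 = 0\<close>), so it is vacuous there, as it is
  with the convention \<open>1 / 0 = \<infinity>\<close>.
\<close>
definition log_hoelder :: "('a::euclidean_space \<Rightarrow> real) \<Rightarrow> bool" where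
  "log_hoelder g \<longleftrightarrow> (\<exists>c>0. \<exists>g_inf. \<forall>x y.
     \<bar>g x - g y\<bar> \<le> c / ln (exp 1 + 1 / norm (x - y)) \<and>
     \<bar>g x - g_inf\<bar> \<le> c / ln (exp 1 + norm x))"

definition log_exps :: "('a::euclidean_space \<Rightarrow> ennreal) set" where
  "log_exps = {p \<in> var_exps. log_hoelder (\<lambda>x. enn2real (1 / p x))}"

text \<open>Since \<open>1 / 0 = \<infinity>\<close> in \<^typ>\<open>ennreal\<close>, this covers the case \<open>p_infty p = \<infinity>\<close>.\<close>
definition p_infty :: "('a::euclidean_space \<Rightarrow> ennreal) \<Rightarrow> ennreal" where
  "p_infty p = 1 / Lim at_infinity (\<lambda>x. 1 / p x)"

definition eta :: "real \<Rightarrow> real \<Rightarrow> 'a::euclidean_space \<Rightarrow> real" where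
  "eta t m x = t powr (- real DIM('a)) * (1 + norm x / t) powr (- m)"

text \<open>
  The Bochner integral is \<open>0\<close> where the integrand is not integrable, so \<open>conv_defined\<close> is needed
  to say that the convolution exists.
\<close>
definition conv ::
    "('a::euclidean_space \<Rightarrow> real) \<Rightarrow> ('a \<Rightarrow> 'k::{banach, second_countable_topology}) \<Rightarrow> 'a \<Rightarrow> 'k"
  where "conv g f x = (LINT y|lebesgue. g (x - y) *\<^sub>R f y)"

definition conv_defined ::
    "('a::euclidean_space \<Rightarrow> real) \<Rightarrow> ('a \<Rightarrow> 'k::{banach, second_countable_topology}) \<Rightarrow> bool"
  where "conv_defined g f \<longleftrightarrow> (AE x in lebesgue. integrable lebesgue (\<lambda>y. g (x - y) *\<^sub>R f y))"

definition omega_exp :: "('a::euclidean_space \<Rightarrow> ennreal) \<Rightarrow> ennreal \<Rightarrow> real \<Rightarrow> real" where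
  "omega_exp p \<nu> t =
     (if t \<le> 1 then enn2real (2 / p_minus p) * (1 - enn2real (\<nu> / (2 * p_plus p)))
      else enn2real (2 / p_plus p) * (1 - enn2real (\<nu> / (2 * p_minus p))))"

definition phi_exp :: "('a::euclidean_space \<Rightarrow> ennreal) \<Rightarrow> real \<Rightarrow> real" where
  "phi_exp p t =
     (if t \<le> 1 then enn2real (2 / p_minus p) - enn2real (1 / p_plus p)
      else enn2real (1 / p_plus p))"

end

theory Submission
  imports Defs
begin

text \<open>
  Neither Hoelder's inequality in variable exponent spaces nor the maximal function is needed. Let
  \<open>u\<close>, \<open>v\<close> have modulars at most \<open>1\<close> and let \<open>T\<close> be \<open>t\<close> to the power \<open>-2n/p\<^sup>-\<close> (if
  \<open>t \<le> 1\<close>) or \<open>-2n/p\<^sup>+\<close> (if \<open>t > 1\<close>). Since \<open>s \<le> 1 + s\<^bsup>q/2\<^esup>\<close> for \<open>q \<ge> 2\<close>, taking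
  \<open>s = |uv|/T\<close> bounds the convolution \<open>g\<close> of the kernel with \<open>|uv|\<close> by a multiple of \<open>T\<close>; by
  Jensen's inequality the integral of \<open>g\<^bsup>\<nu>/2\<^esup>\<close> is bounded as well. The two bounds interpolate
  pointwise: where \<open>g \<le> T\<close>, one has \<open>(g/\<Lambda>)\<^bsup>p\<^esup> \<le> g\<^bsup>\<nu>/2\<^esup>\<close> as soon as
  \<open>\<Lambda>\<close> dominates \<open>T\<close> to the power \<open>1 - \<nu>/(2p)\<close>. This estimate gives the first part when applied to
  \<open>p\<close> and to the constant exponent \<open>\<nu>\<close>. For the second part it is applied with \<open>\<nu> = p\<^sup>-\<close>: the decay
  of \<open>1/p - 1/p\<^sub>\<infinity>\<close> at infinity and \<open>p\<^sup>- = p\<^sub>\<infinity>\<close> embed the variable exponent space into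
  the Lebesgue space with exponent \<open>p\<^sup>-\<close>.
\<close>

section \<open>The kernel\<close>

text \<open>A countable cover by Borel sets of finite measure keeps its measures under completion.
  Tonelli's theorem and the measurability of parameter integrals rest on this.\<close>

lemma sigma_finite_lebesgue: "sigma_finite_measure (lebesgue :: 'a::euclidean_space measure)"
proof
  obtain A :: "'a set set" where A: "countable A" "A \<subseteq> sets lborel" "\<Union>A = space lborel"
      "\<forall>a\<in>A. emeasure lborel a \<noteq> \<infinity>"
    using sigma_finite_measure.sigma_finite_countable[OF sigma_finite_lborel] by blast
  then show "\<exists>A::'a set set. countable A \<and> A \<subseteq> sets lebesgue \<and> \<Union>A = space lebesgue \<and>
      (\<forall>a\<in>A. emeasure lebesgue a \<noteq> \<infinity>)"
    by (intro exI[of _ A]) auto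
qed

text \<open>The measure is nonzero, so its almost-everywhere filter is proper. This extracts
  relations between constants, such as \<open>p_minus p \<le> p_plus p\<close>, from relations that
  hold almost everywhere.\<close>

lemma ex_of_AE_lebesgue:
  assumes "AE x in (lebesgue :: 'a::euclidean_space measure). P x"
  shows "\<exists>x. P x"
proof -
  have "emeasure lebesgue (UNIV :: 'a set) \<noteq> 0" by simp
  then have "ae_filter (lebesgue :: 'a measure) \<noteq> bot"
    using ae_filter_eq_bot_iff[of "lebesgue :: 'a measure"] by simp
  then show ?thesis using assms eventually_happens by blast
qed

lemma eta_pos: "0 < t \<Longrightarrow> 0 < eta t m x"
  using add_pos_nonneg[of 1 "norm x / t"] by (simp add: eta_def)

lemma eta_minus_commute: "eta t m (x - y) = eta t m (y - x)"
  by (simp add: eta_def norm_minus_commute)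

lemma eta_le: "0 < t \<Longrightarrow> 0 \<le> m \<Longrightarrow> eta t m (x :: 'a::euclidean_space) \<le> t powr (- real DIM('a))"
  using powr_mono2'[of "- m" 1 "1 + norm x / t"] by (simp add: eta_def mult_le_cancel_left1)

lemma borel_measurable_eta [measurable]: "eta t m \<in> borel_measurable borel"
  unfolding eta_def by measurable

text \<open>With \<open>s = 1 + norm (x - y) / t\<close>, the lower bound controls the kernel at
  \<open>x - y\<close> and the upper bound places \<open>y\<close> in a dyadic ball.\<close>

lemma ex_dyadic:
  fixes s :: real assumes "1 \<le> s"
  shows "\<exists>k::nat. 2 ^ k \<le> s \<and> s < 2 ^ Suc k"
proof -
  define k where "k = nat \<lfloor>log 2 s\<rfloor>"
  have "0 \<le> log 2 s" using assms by simp
  then have "real k \<le> log 2 s" "log 2 s < real (Suc k)"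
    unfolding k_def by linarith+
  then have "2 powr real k \<le> s" "s < 2 powr real (Suc k)"
    using assms by (auto simp: le_log_iff log_less_iff)
  then show ?thesis by (intro exI[of _ k]) (auto simp: powr_realpow powr_add)
qed

text \<open>
  Covering the space by the balls of radius \<open>2\<^bsup>k+1\<^esup> t\<close> around \<open>x\<close> gives a geometric series from
  which \<open>t\<close> and \<open>x\<close> drop out, so no substitution is needed.
\<close>
lemma eta_integral_bound:
  assumes m: "real DIM('a::euclidean_space) < m"
  obtains H where "1 \<le> H" "\<And>t (x::'a). 0 < t \<Longrightarrow>
    (\<integral>\<^sup>+y. ennreal (eta t m (x - y)) \<partial>lebesgue) \<le> ennreal H"
proof -
  define n where "n = DIM('a)"
  define V where "V = unit_ball_vol (real n)"
  \<comment> \<open>Ratio of the geometric series: doubling the radius multiplies the volume by 2^n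
    and the kernel bound by 2^(-m). It is below 1 because m > n.\<close>
  define q where "q = 2 powr (real n - m)"
  have q: "0 < q" "q < 1"
    using m by (auto simp: q_def n_def intro: powr_less_one)
  have V: "0 \<le> V" by (simp add: V_def)
  define S where "S = V * 2 ^ n * (1 / (1 - q))"
  have S: "0 \<le> S" using V q by (simp add: S_def)
  have bound: "(\<integral>\<^sup>+y. ennreal (eta t m (x - y)) \<partial>lebesgue) \<le> ennreal (max 1 S)"
    if t: "0 < t" for t and x :: 'a
  proof -
    define c where "c k = t powr (- real n) * 2 powr (- (real k * m))" for k :: nat
    define B where "B k = cball x (2 ^ Suc k * t)" for k :: nat
    have c: "0 \<le> c k" for k by (simp add: c_def)
    have [measurable]: "B k \<in> sets lebesgue" for k by (simp add: B_def)
    have pw: "ennreal (eta t m (x - y)) \<le> (\<Sum>k. ennreal (c k) * indicator (B k) y)" for y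
    proof -
      obtain k :: nat where k: "2 ^ k \<le> 1 + norm (x - y) / t" "1 + norm (x - y) / t < 2 ^ Suc k"
        using ex_dyadic[of "1 + norm (x - y) / t"] t by auto
      have "norm (x - y) / t \<le> 2 ^ Suc k" using k by linarith
      then have y: "y \<in> B k"
        using t by (simp add: B_def dist_norm field_simps)
      have "(1 + norm (x - y) / t) powr (- m) \<le> (2 ^ k) powr (- m)"
        using k m by (intro powr_mono2') auto
      also have "(2 ^ k) powr (- m) = 2 powr (- (real k * m))"
        by (simp add: powr_powr flip: powr_realpow)
      finally have "eta t m (x - y) \<le> c k"
        by (simp add: eta_def c_def n_def mult_left_mono)
      then have "ennreal (eta t m (x - y)) \<le> ennreal (c k) * indicator (B k) y"
        using y by (simp add: ennreal_leI)
      also have "\<dots> \<le> (\<Sum>k. ennreal (c k) * indicator (B k) y)"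
        using sum_le_suminf[of "\<lambda>k. ennreal (c k) * indicator (B k) y" "{k}"]
        by (simp del: sum_mult_indicator)
      finally show ?thesis .
    qed
    have shell: "ennreal (c k) * emeasure lebesgue (B k) = ennreal (V * 2 ^ n * q ^ k)" for k
    proof -
      have e: "emeasure lebesgue (B k) = ennreal (V * (2 ^ Suc k * t) ^ n)"
        using t by (simp add: B_def emeasure_cball V_def n_def)
      have 1: "(2 ^ Suc k * t) ^ n = 2 ^ n * (2 powr (real k * real n) * t powr real n)"
        using t by (simp add: power_mult_distrib powr_realpow[symmetric] powr_powr)
      have 2: "q ^ k = 2 powr (- (real k * m)) * 2 powr (real k * real n)"
        by (simp add: q_def powr_powr algebra_simps flip: powr_realpow powr_add)
      have 3: "t powr (- real n) * t powr real n = 1"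
        using t by (simp flip: powr_add)
      have "c k * (V * (2 ^ Suc k * t) ^ n) = V * 2 ^ n * q ^ k * (t powr (- real n) * t powr real n)"
        unfolding c_def 1 2 by (simp only: mult_ac)
      then have "c k * (V * (2 ^ Suc k * t) ^ n) = V * 2 ^ n * q ^ k"
        unfolding 3 by (simp only: mult_1_right)
      then show ?thesis
        unfolding e by (simp only: ennreal_mult'[OF c, symmetric])
    qed
    have "(\<integral>\<^sup>+y. ennreal (eta t m (x - y)) \<partial>lebesgue)
        \<le> (\<integral>\<^sup>+y. (\<Sum>k. ennreal (c k) * indicator (B k) y) \<partial>lebesgue)"
      by (intro nn_integral_mono pw)
    also have "\<dots> = (\<Sum>k. \<integral>\<^sup>+y. ennreal (c k) * indicator (B k) y \<partial>lebesgue)"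
      by (intro nn_integral_suminf) measurable
    also have "\<dots> = (\<Sum>k. ennreal (V * 2 ^ n * q ^ k))"
      by (simp only: nn_integral_cmult_indicator[OF \<open>B _ \<in> sets lebesgue\<close>] shell)
    also have "\<dots> = ennreal S"
      using q V unfolding S_def
      by (intro suminf_ennreal_eq sums_mult geometric_sums) auto
    also have "\<dots> \<le> ennreal (max 1 S)"
      by (intro ennreal_leI) simp
    finally show ?thesis .
  qed
  show ?thesis
    by (rule that[of "max 1 S"]) (use bound in auto)
qed

text \<open>
  \<open>k\<close> need not be normalised: Jensen's inequality is replaced by integrating the tangent line of
  \<open>z\<^bsup>r\<^esup>\<close> at \<open>A / H\<close>, which only uses that the integral of \<open>k\<close> is at most \<open>H\<close>.
\<close>
lemma jensen_kernel:
  fixes k s :: "'a \<Rightarrow> real"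
  assumes [measurable]: "k \<in> borel_measurable M" "s \<in> borel_measurable M"
    and nn: "\<And>x. 0 \<le> k x" "\<And>x. 0 \<le> s x"
    and H: "0 < H" "(\<integral>\<^sup>+x. ennreal (k x) \<partial>M) \<le> ennreal H"
    and r: "1 \<le> r" and A: "0 \<le> A" "(\<integral>\<^sup>+x. ennreal (k x * s x) \<partial>M) = ennreal A"
  shows "ennreal (A powr r) \<le> ennreal (H powr (r - 1)) * (\<integral>\<^sup>+x. ennreal (k x * s x powr r) \<partial>M)"
proof (cases "A = 0 \<or> (\<integral>\<^sup>+x. ennreal (k x * s x powr r) \<partial>M) = \<infinity>")
  \<comment> \<open>For \<open>A = 0\<close> the left side vanishes; an infinite integral makes the
    right side infinite, since \<open>H powr (r - 1)\<close> is positive.\<close>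
  case True
  then show ?thesis using H by (auto simp: ennreal_mult_top)
next
  case False
  define I where "I = enn2real (\<integral>\<^sup>+x. ennreal (k x * s x powr r) \<partial>M)"
  have I: "(\<integral>\<^sup>+x. ennreal (k x * s x powr r) \<partial>M) = ennreal I" "0 \<le> I"
    using False by (auto simp: I_def less_top)
  define B where "B = A / H"
  have B: "0 < B" using False A H by (simp add: B_def)
  \<comment> \<open>The tangent line at \<open>B\<close> is Young's inequality with weights
    \<open>1 / r\<close> and \<open>1 - 1 / r\<close>, applied to z^r and B^r and multiplied by
    \<open>r\<close>.\<close>
  have young: "r * B powr (r - 1) * z \<le> z powr r + (r - 1) * B powr r" if "0 \<le> z" for z
  proof (cases "z = 0")
    case True then show ?thesis using r by simp
  next
    case False
    have "(z powr r) powr (1 / r) * (B powr r) powr (1 - 1 / r) \<le> 1 / r * z powr r + (1 - 1 / r) * B powr r"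
      using r False B that by (intro Youngs_inequality_0) auto
    also have "(z powr r) powr (1 / r) * (B powr r) powr (1 - 1 / r) = z * B powr (r - 1)"
      using r that by (simp add: powr_powr algebra_simps)
    finally have "r * (z * B powr (r - 1)) \<le> r * (1 / r * z powr r + (1 - 1 / r) * B powr r)"
      using r by (intro mult_left_mono) auto
    also have "\<dots> = z powr r + (r - 1) * B powr r" using r by (simp add: field_simps)
    finally show ?thesis by (simp add: mult_ac)
  qed
  have "ennreal (r * B powr (r - 1) * A) = ennreal (r * B powr (r - 1)) * (\<integral>\<^sup>+x. ennreal (k x * s x) \<partial>M)"
    using A r by (simp add: ennreal_mult')
  also have "\<dots> = (\<integral>\<^sup>+x. ennreal (r * B powr (r - 1)) * ennreal (k x * s x) \<partial>M)"
    by (simp add: nn_integral_cmult)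
  also have "\<dots> \<le> (\<integral>\<^sup>+x. ennreal (k x * s x powr r) + ennreal ((r - 1) * B powr r) * ennreal (k x) \<partial>M)"
  proof (rule nn_integral_mono)
    fix x
    have "k x * (r * B powr (r - 1) * s x) \<le> k x * (s x powr r + (r - 1) * B powr r)"
      using nn young by (intro mult_left_mono) auto
    then have "ennreal (r * B powr (r - 1) * (k x * s x))
        \<le> ennreal (k x * s x powr r + (r - 1) * B powr r * k x)"
      by (intro ennreal_leI) (simp add: algebra_simps)
    then show "ennreal (r * B powr (r - 1)) * ennreal (k x * s x)
        \<le> ennreal (k x * s x powr r) + ennreal ((r - 1) * B powr r) * ennreal (k x)"
      using r nn by (simp add: ennreal_plus ennreal_mult)
  qed
  also have "\<dots> = ennreal I + ennreal ((r - 1) * B powr r) * (\<integral>\<^sup>+x. ennreal (k x) \<partial>M)"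
    by (simp add: nn_integral_add nn_integral_cmult I)
  also have "\<dots> \<le> ennreal I + ennreal ((r - 1) * B powr r) * ennreal H"
    by (intro add_left_mono mult_left_mono H) auto
  also have "\<dots> = ennreal (I + (r - 1) * B powr r * H)"
    using I r H by (simp flip: ennreal_mult ennreal_plus)
  finally have "r * B powr (r - 1) * A \<le> I + (r - 1) * B powr r * H"
    using I r H by (subst (asm) ennreal_le_iff) auto
  moreover have "B powr (r - 1) * A = B powr r * H"
    using B H False A by (simp add: powr_diff B_def)
  ultimately have "r * (B powr r * H) \<le> I + (r - 1) * (B powr r * H)"
    by (simp add: mult.assoc)
  then have "B powr r * H \<le> I"
    by (simp add: left_diff_distrib)
  then have "H powr (r - 1) * (B powr r * H) \<le> H powr (r - 1) * I"
    by (intro mult_left_mono) auto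
  moreover have "H powr (r - 1) * (B powr r * H) = A powr r"
    using H A by (simp add: B_def powr_divide powr_diff)
  ultimately show ?thesis
    using I by (simp add: ennreal_leI flip: ennreal_mult)
qed

section \<open>Modulars and Luxemburg norms\<close>

text \<open>The supremum is already that of a sequence of admissible constants, so only countably
  many null sets have to be united.\<close>

lemma AE_p_minus_le: "AE x in lebesgue. p_minus p \<le> p x"
proof -
  let ?Z = "{z. AE x in lebesgue. z \<le> p x}"
  have "0 \<in> ?Z" by simp
  then have "?Z \<noteq> {}" by blast
  from ennreal_Sup_countable_SUP[OF this]
  obtain f :: "nat \<Rightarrow> ennreal" where f: "range f \<subseteq> ?Z" "Sup ?Z = Sup (range f)"
    by blast
  have "AE x in lebesgue. f i \<le> p x" for i using f(1) by auto
  then have "AE x in lebesgue. \<forall>i. f i \<le> p x"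
    by (simp add: AE_all_countable)
  then show ?thesis
    by eventually_elim (auto simp: p_minus_def f(2) intro: SUP_least)
qed

lemma AE_le_p_plus: "p \<in> borel_measurable lebesgue \<Longrightarrow> AE x in lebesgue. p x \<le> p_plus p"
  unfolding p_plus_def by (rule esssup_AE)

lemma omega_mod_mono: "0 \<le> a \<Longrightarrow> a \<le> b \<Longrightarrow> omega_mod q a \<le> omega_mod q b"
  by (auto simp: omega_mod_def intro!: ennreal_leI powr_mono2)

text \<open>Convexity together with the value 0 at 0: for finite \<open>q\<close> it is a^q \<le> a.
  For q = \<infinity>, either b \<le> 1 and the left side vanishes, or the right side is
  infinite.\<close>

lemma omega_mod_scale_le:
  assumes "1 \<le> q" "0 < a" "a \<le> 1" "0 \<le> b"
  shows "omega_mod q (a * b) \<le> ennreal a * omega_mod q b"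
proof (cases "q = \<infinity>")
  case True
  then show ?thesis
    using assms mult_mono[of a 1 b 1] by (auto simp: omega_mod_def ennreal_mult_top)
next
  case False
  then have "1 \<le> enn2real q"
    using assms(1) by (cases q) auto
  then have "a powr enn2real q \<le> a"
    using powr_mono'[of 1 "enn2real q" a] assms by simp
  then show ?thesis
    using False assms
    by (auto simp: omega_mod_def powr_mult mult_right_mono simp flip: ennreal_mult' intro!: ennreal_leI)
qed

lemma borel_measurable_omega_mod [measurable]:
  assumes [measurable]: "q \<in> borel_measurable M" "f \<in> borel_measurable M"
  shows "(\<lambda>x. omega_mod (q x) (f x)) \<in> borel_measurable M"
  unfolding omega_mod_def by measurable

lemma modular_mono_AE:
  "AE x in lebesgue. norm (f x) \<le> norm (g x) \<Longrightarrow> modular q f \<le> modular q g"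
  unfolding modular_def by (intro nn_integral_mono_AE) (auto elim!: eventually_mono intro: omega_mod_mono)

lemma modular_cong_AE: "AE x in lebesgue. p x = q x \<Longrightarrow> modular p f = modular q f"
  unfolding modular_def by (intro nn_integral_cong_AE) (auto elim!: eventually_mono)

text \<open>Guarantees that the infimum in \<open>Lp_norm\<close> runs over a nonempty set. Scaling
  the function by 1/(1 + J), where J is a finite modular, brings the modular down to at most
  1.\<close>

lemma Lp_space_modular_le_one:
  assumes q: "q \<in> borel_measurable lebesgue" "\<And>x. 1 \<le> q x" and f: "f \<in> Lp_space q"
  shows "\<exists>s>0. modular q (\<lambda>x. f x /\<^sub>R s) \<le> 1"
proof -
  note [measurable] = q(1)
  obtain s where s: "0 < s" "modular q (\<lambda>x. s *\<^sub>R f x) < \<infinity>" and [measurable]: "f \<in> borel_measurable lebesgue"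
    using f by (auto simp: Lp_space_def)
  define J where "J = enn2real (modular q (\<lambda>x. s *\<^sub>R f x))"
  have J: "modular q (\<lambda>x. s *\<^sub>R f x) = ennreal J" "0 \<le> J"
    using s by (auto simp: J_def)
  define a where "a = 1 / (1 + J)"
  have a: "0 < a" "a \<le> 1" "a * J \<le> 1" using J by (auto simp: a_def field_simps)
  have "modular q (\<lambda>x. f x /\<^sub>R (inverse (a * s)))
      \<le> (\<integral>\<^sup>+x. ennreal a * omega_mod (q x) (norm (s *\<^sub>R f x)) \<partial>lebesgue)"
    unfolding modular_def
  proof (rule nn_integral_mono)
    fix x
    show "omega_mod (q x) (norm (f x /\<^sub>R inverse (a * s)))
        \<le> ennreal a * omega_mod (q x) (norm (s *\<^sub>R f x))"
      using omega_mod_scale_le[OF q(2)[of x] a(1,2), of "norm (s *\<^sub>R f x)"] a s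
      by (simp add: mult.assoc)
  qed
  also have "\<dots> = ennreal a * ennreal J"
    unfolding J(1)[symmetric] modular_def by (rule nn_integral_cmult) measurable
  also have "\<dots> \<le> 1"
    using a J by (simp flip: ennreal_mult)
  finally show ?thesis
    using a s by (intro exI[of _ "inverse (a * s)"]) auto
qed

text \<open>A number strictly above the infimum exceeds some admissible scale, and the modular
  decreases as the scale grows. Strictness avoids the question whether the infimum is
  attained.\<close>

lemma modular_le_one_of_Lp_norm_less:
  assumes q: "q \<in> borel_measurable lebesgue" "\<And>x. 1 \<le> q x" and f: "f \<in> Lp_space q"
    and less: "Lp_norm q f < l"
  shows "0 < l" "modular q (\<lambda>x. f x /\<^sub>R l) \<le> 1"
proof -
  let ?S = "{s::real. s > 0 \<and> modular q (\<lambda>x. f x /\<^sub>R s) \<le> 1}"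
  have "?S \<noteq> {}" using Lp_space_modular_le_one[OF q f] by auto
  then obtain s where s: "s \<in> ?S" "s < l"
    using less unfolding Lp_norm_def by (meson cInf_lessD)
  then show "0 < l" by simp
  have "modular q (\<lambda>x. f x /\<^sub>R l) \<le> modular q (\<lambda>x. f x /\<^sub>R s)"
    using s by (intro modular_mono_AE AE_I2) (auto simp: mult_right_mono)
  then show "modular q (\<lambda>x. f x /\<^sub>R l) \<le> 1" using s by auto
qed

lemma Lp_norm_nonneg:
  assumes "q \<in> borel_measurable lebesgue" "\<And>x. 1 \<le> q x" "f \<in> Lp_space q"
  shows "0 \<le> Lp_norm q f"
  unfolding Lp_norm_def using Lp_space_modular_le_one[OF assms] by (intro cInf_greatest) auto

lemma Lp_norm_le:
  assumes "0 < l" "modular q (\<lambda>x. f x /\<^sub>R l) \<le> 1"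
  shows "Lp_norm q f \<le> l"
  unfolding Lp_norm_def by (intro cInf_lower bdd_belowI[of _ 0]) (use assms in auto)

lemma Lp_spaceI:
  assumes "f \<in> borel_measurable lebesgue" "0 < l" "modular q (\<lambda>x. f x /\<^sub>R l) \<le> 1"
  shows "f \<in> Lp_space q"
  unfolding Lp_space_def using assms
  by (auto intro!: exI[of _ "inverse l"] elim: le_less_trans)

text \<open>For finite \<open>q\<close> this is x \<le> 1 + x^(q/2) with x = ab/T, multiplied by T;
  the factor T^(-q/2) is replaced by the bound \<open>d\<close>, which does not depend on
  \<open>q\<close>. For q = \<infinity>, either ab \<le> 1 \<le> T or the right side is
  infinite.\<close>

lemma young_omega_mod:
  assumes T: "0 < T" and t: "0 < t" and ab: "0 \<le> a" "0 \<le> b"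
    and inf: "q = \<infinity> \<Longrightarrow> 1 \<le> T"
    and fin: "q \<noteq> \<infinity> \<Longrightarrow> 2 \<le> q \<and> T powr (- (enn2real q / 2)) \<le> d" and d: "0 < d"
  shows "ennreal (a * b) \<le> ennreal T + ennreal (T * d) * (omega_mod q a + omega_mod q b)"
proof (cases "q = \<infinity>")
  case True
  show ?thesis
  proof (cases "a \<le> 1 \<and> b \<le> 1")
    case True
    then have "a * b \<le> T" using mult_mono[of a 1 b 1] ab inf[OF \<open>q = \<infinity>\<close>] by linarith
    then show ?thesis by (simp add: ennreal_leI add_increasing2)
  next
    case False
    then show ?thesis using \<open>q = \<infinity>\<close> T d by (auto simp: omega_mod_def ennreal_mult_top)
  qed
next
  case False
  define Q where "Q = enn2real q"
  have Q: "2 \<le> Q" "T powr (- (Q / 2)) \<le> d"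
    using fin[OF False] False by (cases q; auto simp: Q_def)+
  \<comment> \<open>Passing to the maximum separates the two factors: the product is at most s^2,
    while s^Q is at most the sum of the two powers.\<close>
  define s where "s = max a b"
  have s: "0 \<le> s" "a * b \<le> s * s" "s powr Q \<le> a powr Q + b powr Q"
    using ab by (auto simp: s_def max_def intro: mult_mono)
  have "s * s \<le> T + T * d * s powr Q"
  proof (cases "s * s \<le> T")
    case True
    then show ?thesis using T d by (simp add: add_increasing2)
  next
    case False
    then have s0: "0 < s" using s T by (cases "s = 0") auto
    \<comment> \<open>The base exceeds 1 and Q/2 \<ge> 1, so raising to the power Q/2 can only
      increase it.\<close>
    have "(s * s / T) powr 1 \<le> (s * s / T) powr (Q / 2)"
      using False T Q by (intro powr_mono) auto
    also have "\<dots> = s powr Q * T powr (- (Q / 2))"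
    proof -
      have "s * s = s powr 2" using s0 by (simp add: power2_eq_square)
      then show ?thesis using T by (simp add: powr_divide powr_powr powr_minus_divide)
    qed
    also have "\<dots> \<le> s powr Q * d"
      using Q by (intro mult_left_mono) auto
    finally have "s * s / T \<le> s powr Q * d" using s0 T by simp
    then show ?thesis using T by (simp add: field_simps)
  qed
  also have "\<dots> \<le> T + T * d * (a powr Q + b powr Q)"
    using s T d by (intro add_left_mono mult_left_mono) auto
  finally have "ennreal (a * b) \<le> ennreal (T + T * d * (a powr Q + b powr Q))"
    using s by (intro ennreal_leI) linarith
  then show ?thesis
    using False T d by (simp add: omega_mod_def Q_def[symmetric] ennreal_plus ennreal_mult)
qed

text \<open>Split g^q = g^r g^(q-r). The second factor is at most T^(q-r) = (T^(1-r/q))^q, hence at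
  most L^q. For q = \<infinity> the quotient is at most 1 and the left side vanishes. It is used
  with r = \<nu>/2.\<close>

lemma omega_mod_interpolate:
  assumes g: "0 \<le> g" "g \<le> T" and T: "0 < T" and L: "0 < L"
    and inf: "q = \<infinity> \<Longrightarrow> T \<le> L"
    and fin: "q \<noteq> \<infinity> \<Longrightarrow> r \<le> enn2real q \<and> T powr (1 - r / enn2real q) \<le> L" and r: "0 < r"
  shows "omega_mod q (g / L) \<le> ennreal (g powr r)"
proof (cases "q = \<infinity>")
  case True
  then show ?thesis using inf g L by (auto simp: omega_mod_def)
next
  case False
  define Q where "Q = enn2real q"
  have Q: "r \<le> Q" "T powr (1 - r / Q) \<le> L" "0 < Q"
    using fin[OF False] r by (auto simp: Q_def)
  have "(g / L) powr Q \<le> g powr r"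
  proof (cases "g = 0")
    case False
    then have g0: "0 < g" using g by simp
    have "g powr (Q - r) \<le> T powr (Q - r)" using g Q by (intro powr_mono2) auto
    also have "\<dots> = (T powr (1 - r / Q)) powr Q" using Q by (simp add: powr_powr algebra_simps)
    also have "\<dots> \<le> L powr Q" using Q by (intro powr_mono2) auto
    finally have "g powr Q \<le> L powr Q * g powr r" using g0 by (simp add: powr_diff field_simps)
    then show ?thesis using g0 L by (simp add: powr_divide field_simps)
  qed auto
  then show ?thesis using False by (auto simp: omega_mod_def Q_def intro: ennreal_leI)
qed

section \<open>Convolution with the kernel\<close>

lemma borel_measurable_eta_diff:
  "(\<lambda>(x, y). eta t m (x - y)) \<in> borel_measurable (lebesgue \<Otimes>\<^sub>M (lebesgue :: 'a::euclidean_space measure))"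
proof -
  have [measurable]: "(\<lambda>x::'a. x) \<in> borel_measurable lebesgue"
    by (simp add: measurable_completion)
  show ?thesis by measurable
qed

lemma borel_measurable_eta_section:
  "(\<lambda>y. eta t m (x - y)) \<in> borel_measurable (lebesgue :: 'a::euclidean_space measure)"
  using measurable_Pair2[OF borel_measurable_eta_diff, of x] by simp

lemma borel_measurable_conv:
  assumes "f \<in> borel_measurable lebesgue"
  shows "conv (eta t m) f \<in> borel_measurable lebesgue"
proof -
  note [measurable] = borel_measurable_eta_diff assms
  have "(\<lambda>(x, y). eta t m (x - y) *\<^sub>R f y) \<in> borel_measurable (lebesgue \<Otimes>\<^sub>M lebesgue)"
    by measurable
  then have "(\<lambda>x. LINT y|lebesgue. eta t m (x - y) *\<^sub>R f y) \<in> borel_measurable lebesgue"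
    by (rule sigma_finite_measure.borel_measurable_lebesgue_integral[OF sigma_finite_lebesgue])
  then show ?thesis by (simp add: conv_def[abs_def])
qed

text \<open>After \<open>young_omega_mod\<close>, the constant term is integrated against the
  kernel, which gives \<open>T * H\<close>. In the modular terms the kernel is bounded by its
  maximum t^(-n), which cancels the factor t^n; each modular then contributes at most T.\<close>

lemma kernel_sup_bound:
  fixes u v :: "'a::euclidean_space \<Rightarrow> 'k::real_normed_vector"
  assumes [measurable]: "q \<in> borel_measurable lebesgue" "u \<in> borel_measurable lebesgue"
      "v \<in> borel_measurable lebesgue"
    and t: "0 < t" and T: "0 < T" and m: "0 \<le> m"
    and q: "AE y in lebesgue. (q y = \<infinity> \<longrightarrow> 1 \<le> T) \<and>
      (q y \<noteq> \<infinity> \<longrightarrow> 2 \<le> q y \<and> T powr (- (enn2real (q y) / 2)) \<le> t powr real DIM('a))"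
    and uv: "modular q u \<le> 1" "modular q v \<le> 1"
    and H: "0 \<le> H" "(\<integral>\<^sup>+y. ennreal (eta t m (x - y)) \<partial>lebesgue) \<le> ennreal H"
  shows "(\<integral>\<^sup>+y. ennreal (eta t m (x - y) * (norm (u y) * norm (v y))) \<partial>lebesgue) \<le> ennreal (T * (H + 2))"
proof -
  note [measurable] = borel_measurable_eta_section
  define d where "d = t powr real DIM('a)"
  have d: "0 < d" using t by (simp add: d_def)
  have eta_d: "eta t m (x - y) * d \<le> 1" for y
  proof -
    have "eta t m (x - y) * d \<le> t powr (- real DIM('a)) * d"
      using d t m by (intro mult_right_mono eta_le) auto
    also have "\<dots> = 1" using t by (simp add: d_def flip: powr_add)
    finally show ?thesis .
  qed
  let ?W = "\<lambda>y. omega_mod (q y) (norm (u y)) + omega_mod (q y) (norm (v y))"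
  have "(\<integral>\<^sup>+y. ennreal (eta t m (x - y) * (norm (u y) * norm (v y))) \<partial>lebesgue)
     \<le> (\<integral>\<^sup>+y. ennreal T * ennreal (eta t m (x - y)) + ennreal T * ?W y \<partial>lebesgue)"
  proof (rule nn_integral_mono_AE, use q in eventually_elim)
    case (elim y)
    have e: "0 \<le> eta t m (x - y)" using eta_pos[OF t] less_imp_le by blast
    have "ennreal (eta t m (x - y) * (norm (u y) * norm (v y)))
        = ennreal (eta t m (x - y)) * ennreal (norm (u y) * norm (v y))"
      using e by (rule ennreal_mult')
    also have "\<dots> \<le> ennreal (eta t m (x - y)) * (ennreal T + ennreal (T * d) * ?W y)"
      using elim T t d by (intro mult_left_mono young_omega_mod) (auto simp: d_def)
    also have "\<dots> = ennreal T * ennreal (eta t m (x - y)) + ennreal (T * (eta t m (x - y) * d)) * ?W y"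
      using e T d by (simp add: distrib_left ennreal_mult mult_ac)
    also have "\<dots> \<le> ennreal T * ennreal (eta t m (x - y)) + ennreal T * ?W y"
      using eta_d[of y] T by (intro add_left_mono mult_right_mono ennreal_leI) (auto simp: mult_le_cancel_left1)
    finally show ?case .
  qed
  also have "\<dots> = ennreal T * (\<integral>\<^sup>+y. ennreal (eta t m (x - y)) \<partial>lebesgue)
      + ennreal T * (modular q u + modular q v)"
    by (simp add: nn_integral_add nn_integral_cmult modular_def)
  also have "\<dots> \<le> ennreal T * ennreal H + ennreal T * (1 + 1)"
    by (intro add_mono mult_left_mono H uv) auto
  also have "(1 + 1 :: ennreal) = ennreal 2"
    using ennreal_plus[of 1 1] by simp
  also have "ennreal T * ennreal H + ennreal T * ennreal 2 = ennreal (T * (H + 2))"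
    using T H(1) by (simp add: distrib_left ennreal_plus ennreal_mult del: ennreal_numeral)
  finally show ?thesis .
qed

text \<open>Apply Jensen's inequality for each \<open>x\<close> and exchange the integrals. By
  symmetry of the kernel its integral over \<open>x\<close> is again at most \<open>H\<close>, which
  raises H^(r-1) to H^r.\<close>

lemma kernel_power_bound:
  fixes s :: "'a::euclidean_space \<Rightarrow> real"
  assumes [measurable]: "s \<in> borel_measurable lebesgue" and s: "\<And>y. 0 \<le> s y"
    and t: "0 < t" and H: "0 < H" "\<And>x::'a. (\<integral>\<^sup>+y. ennreal (eta t m (x - y)) \<partial>lebesgue) \<le> ennreal H"
    and r: "1 \<le> r"
    and fin: "\<And>x. (\<integral>\<^sup>+y. ennreal (eta t m (x - y) * s y) \<partial>lebesgue) < \<infinity>"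
  shows "(\<integral>\<^sup>+x. ennreal (enn2real (\<integral>\<^sup>+y. ennreal (eta t m (x - y) * s y) \<partial>lebesgue) powr r) \<partial>lebesgue)
    \<le> ennreal (H powr r) * (\<integral>\<^sup>+y. ennreal (s y powr r) \<partial>lebesgue)"
proof -
  note [measurable] = borel_measurable_eta_section borel_measurable_eta_diff
  interpret L: sigma_finite_measure "lebesgue :: 'a measure" by (rule sigma_finite_lebesgue)
  interpret P: pair_sigma_finite "lebesgue :: 'a measure" "lebesgue :: 'a measure" ..
  have e: "0 \<le> eta t m (x::'a)" for x using eta_pos[OF t] less_imp_le by blast
  have "(\<integral>\<^sup>+x. ennreal (enn2real (\<integral>\<^sup>+y. ennreal (eta t m (x - y) * s y) \<partial>lebesgue) powr r) \<partial>lebesgue)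
     \<le> (\<integral>\<^sup>+x. ennreal (H powr (r - 1)) * (\<integral>\<^sup>+y. ennreal (eta t m (x - y) * s y powr r) \<partial>lebesgue) \<partial>lebesgue)"
    by (intro nn_integral_mono jensen_kernel) (use e s H r fin in \<open>auto simp: less_top\<close>)
  also have "\<dots> = ennreal (H powr (r - 1)) *
      (\<integral>\<^sup>+x. \<integral>\<^sup>+y. ennreal (eta t m (x - y) * s y powr r) \<partial>lebesgue \<partial>lebesgue)"
    by (intro nn_integral_cmult) measurable
  also have "(\<integral>\<^sup>+x. \<integral>\<^sup>+y. ennreal (eta t m (x - y) * s y powr r) \<partial>lebesgue \<partial>lebesgue)
     = (\<integral>\<^sup>+y. \<integral>\<^sup>+x. ennreal (eta t m (x - y) * s y powr r) \<partial>lebesgue \<partial>lebesgue)"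
    by (rule P.Fubini'[symmetric]) measurable
  also have "\<dots> = (\<integral>\<^sup>+y. (\<integral>\<^sup>+x. ennreal (eta t m (y - x)) \<partial>lebesgue) * ennreal (s y powr r) \<partial>lebesgue)"
    by (simp add: ennreal_mult e nn_integral_multc eta_minus_commute)
  also have "\<dots> \<le> (\<integral>\<^sup>+y. ennreal H * ennreal (s y powr r) \<partial>lebesgue)"
    by (intro nn_integral_mono mult_right_mono H) auto
  also have "\<dots> = ennreal H * (\<integral>\<^sup>+y. ennreal (s y powr r) \<partial>lebesgue)"
    by (intro nn_integral_cmult) measurable
  also have "ennreal (H powr (r - 1)) * \<dots> = ennreal (H powr r) * (\<integral>\<^sup>+y. ennreal (s y powr r) \<partial>lebesgue)"
    using H(1) by (simp add: powr_diff flip: mult.assoc ennreal_mult)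
  finally show ?thesis by (simp add: mult_left_mono)
qed

text \<open>The inequality of arithmetic and geometric means, with the factor 1/2 given away. It
  bounds the integral of |uv|^r by two modulars with the constant exponent \<nu> = 2r.\<close>

lemma mult_powr_le:
  fixes a b r :: real
  assumes "0 \<le> a" "0 \<le> b" "0 < r"
  shows "(a * b) powr r \<le> a powr (2 * r) + b powr (2 * r)"
proof -
  have "0 \<le> (a powr r)\<^sup>2 + (b powr r)\<^sup>2 - 2 * (a powr r * b powr r)"
    using zero_le_power2[of "a powr r - b powr r"] by (simp add: power2_diff)
  moreover have "(x powr r)\<^sup>2 = x powr (2 * r)" for x :: real
    by (simp only: power2_eq_square mult_2 powr_add)
  moreover have "0 \<le> a powr r * b powr r" by simp
  ultimately have "a powr r * b powr r \<le> a powr (2 * r) + b powr (2 * r)"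
    by (smt (verit))
  then show ?thesis using assms by (simp add: powr_mult)
qed

lemma norm_conv_le:
  fixes u v :: "'a::euclidean_space \<Rightarrow> 'k::{real_normed_field, banach, second_countable_topology}"
  assumes [measurable]: "u \<in> borel_measurable lebesgue" "v \<in> borel_measurable lebesgue" and t: "0 < t"
    and fin: "(\<integral>\<^sup>+y. ennreal (eta t m (x - y) * (norm (u y) * norm (v y))) \<partial>lebesgue) < \<infinity>"
  shows "integrable lebesgue (\<lambda>y. eta t m (x - y) *\<^sub>R (u y * v y))"
    "ennreal (norm (conv (eta t m) (\<lambda>y. u y * v y) x))
      \<le> (\<integral>\<^sup>+y. ennreal (eta t m (x - y) * (norm (u y) * norm (v y))) \<partial>lebesgue)"
proof -
  note [measurable] = borel_measurable_eta_section
  have e: "norm (eta t m (x - y) *\<^sub>R (u y * v y)) = eta t m (x - y) * (norm (u y) * norm (v y))" for y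
    using eta_pos[OF t, of m "x - y"] by (simp add: norm_mult)
  show i: "integrable lebesgue (\<lambda>y. eta t m (x - y) *\<^sub>R (u y * v y))"
    by (rule integrableI_bounded) (use fin e in auto)
  show "ennreal (norm (conv (eta t m) (\<lambda>y. u y * v y) x))
      \<le> (\<integral>\<^sup>+y. ennreal (eta t m (x - y) * (norm (u y) * norm (v y))) \<partial>lebesgue)"
    using integral_norm_bound_ennreal[OF i] by (simp only: conv_def e)
qed

text \<open>The case of finite \<nu> = 2r: the normalised convolution \<open>g\<close> satisfies g
  \<le> T, so \<open>omega_mod_interpolate\<close> reduces its modular to the integral of g^r, which
  \<open>kernel_power_bound\<close> controls.\<close>

lemma conv_modular_le_one:
  fixes u v :: "'a::euclidean_space \<Rightarrow> 'k::{real_normed_field, banach, second_countable_topology}"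
  assumes [measurable]: "q \<in> borel_measurable lebesgue" "u \<in> borel_measurable lebesgue"
      "v \<in> borel_measurable lebesgue"
    and t: "0 < t" and T: "0 < T" and m: "0 \<le> m" and L: "0 < L"
    and q: "AE y in lebesgue. (q y = \<infinity> \<longrightarrow> 1 \<le> T) \<and>
      (q y \<noteq> \<infinity> \<longrightarrow> 2 \<le> q y \<and> T powr (- (enn2real (q y) / 2)) \<le> t powr real DIM('a))"
    and q': "AE y in lebesgue. (q y = \<infinity> \<longrightarrow> T \<le> L) \<and>
      (q y \<noteq> \<infinity> \<longrightarrow> r \<le> enn2real (q y) \<and> T powr (1 - r / enn2real (q y)) \<le> L)"
    and uv: "modular q u \<le> 1" "modular q v \<le> 1"
    and r: "1 \<le> r" and uv': "modular (\<lambda>_. ennreal (2 * r)) u \<le> 1" "modular (\<lambda>_. ennreal (2 * r)) v \<le> 1"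
    and H: "0 < H" "\<And>x::'a. (\<integral>\<^sup>+y. ennreal (eta t m (x - y)) \<partial>lebesgue) \<le> ennreal H"
  shows "modular q (\<lambda>x. conv (eta t m) (\<lambda>y. u y * v y) x /\<^sub>R ((2 * H + 2) * L)) \<le> 1"
proof -
  define G where "G x = (\<integral>\<^sup>+y. ennreal (eta t m (x - y) * (norm (u y) * norm (v y))) \<partial>lebesgue)" for x
  \<comment> \<open>One constant serves two purposes: c \<ge> H + 2 turns the supremum bound into g
    \<le> T, and c \<ge> 2H absorbs the factor 2 H^r \<le> (2H)^r left by the two modulars.\<close>
  define c where "c = 2 * H + 2"
  define g where "g x = norm (conv (eta t m) (\<lambda>y. u y * v y) x) / c" for x
  have c: "0 < c" "H + 2 \<le> c" "2 * H \<le> c" using H by (auto simp: c_def)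
  have G: "G x \<le> ennreal (T * (H + 2))" for x
    unfolding G_def by (rule kernel_sup_bound) (use assms in auto)
  have Gfin: "G x < \<infinity>" for x
    using le_less_trans[OF G[of x] ennreal_less_top] by simp
  have gG: "norm (conv (eta t m) (\<lambda>y. u y * v y) x) \<le> enn2real (G x)" for x
  proof -
    have "ennreal (norm (conv (eta t m) (\<lambda>y. u y * v y) x)) \<le> G x"
      using norm_conv_le(2)[of u v t m x] t Gfin[of x] by (simp add: G_def)
    then show ?thesis using Gfin[of x] by (cases "G x") auto
  qed
  have gT: "g x \<le> T" for x
  proof -
    have "enn2real (G x) \<le> T * (H + 2)"
      using G[of x] T H Gfin[of x] by (cases "G x") auto
    also have "\<dots> \<le> T * c" using c T by simp
    finally show ?thesis using gG[of x] c by (simp add: g_def field_simps)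
  qed
  have g0: "0 \<le> g x" for x using c by (simp add: g_def)
  have "modular q (\<lambda>x. conv (eta t m) (\<lambda>y. u y * v y) x /\<^sub>R (c * L))
      = (\<integral>\<^sup>+x. omega_mod (q x) (g x / L) \<partial>lebesgue)"
    using c L by (simp add: modular_def g_def divide_inverse mult_ac)
  also have "\<dots> \<le> (\<integral>\<^sup>+x. ennreal (g x powr r) \<partial>lebesgue)"
  proof (rule nn_integral_mono_AE, use q' in eventually_elim)
    case (elim x)
    then show ?case using omega_mod_interpolate[of "g x" T L "q x" r] g0 gT T L r by auto
  qed
  also have "\<dots> \<le> (\<integral>\<^sup>+x. ennreal (c powr (- r)) * ennreal (enn2real (G x) powr r) \<partial>lebesgue)"
  proof (rule nn_integral_mono)
    fix x
    have "g x powr r = c powr (- r) * norm (conv (eta t m) (\<lambda>y. u y * v y) x) powr r"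
      using c by (simp add: g_def powr_divide powr_minus_divide)
    also have "\<dots> \<le> c powr (- r) * enn2real (G x) powr r"
      using gG[of x] r by (intro mult_left_mono powr_mono2) auto
    finally show "ennreal (g x powr r) \<le> ennreal (c powr (- r)) * ennreal (enn2real (G x) powr r)"
      by (simp add: ennreal_leI flip: ennreal_mult)
  qed
  also have "\<dots> = ennreal (c powr (- r)) * (\<integral>\<^sup>+x. ennreal (enn2real (G x) powr r) \<partial>lebesgue)"
  proof (rule nn_integral_cmult)
    interpret L: sigma_finite_measure "lebesgue :: 'a measure" by (rule sigma_finite_lebesgue)
    note [measurable] = borel_measurable_eta_diff
    have [measurable]: "G \<in> borel_measurable lebesgue"
      unfolding G_def[abs_def] by measurable
    show "(\<lambda>x. ennreal (enn2real (G x) powr r)) \<in> borel_measurable lebesgue" by measurable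
  qed
  also have "\<dots> \<le> ennreal (c powr (- r)) * (ennreal (H powr r) * ennreal 2)"
  proof (rule mult_left_mono)
    have "(\<integral>\<^sup>+x. ennreal (enn2real (G x) powr r) \<partial>lebesgue)
        \<le> ennreal (H powr r) * (\<integral>\<^sup>+y. ennreal ((norm (u y) * norm (v y)) powr r) \<partial>lebesgue)"
      unfolding G_def
      by (rule kernel_power_bound) (use t H r Gfin in \<open>auto simp: G_def\<close>)
    also have "(\<integral>\<^sup>+y. ennreal ((norm (u y) * norm (v y)) powr r) \<partial>lebesgue)
        \<le> (\<integral>\<^sup>+y. ennreal (norm (u y) powr (2 * r)) + ennreal (norm (v y) powr (2 * r)) \<partial>lebesgue)"
      using r by (intro nn_integral_mono) (simp add: mult_powr_le ennreal_leI flip: ennreal_plus)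
    also have "\<dots> = modular (\<lambda>_. ennreal (2 * r)) u + modular (\<lambda>_. ennreal (2 * r)) v"
      using r by (subst nn_integral_add) (auto simp: modular_def omega_mod_def)
    also have "\<dots> \<le> 1 + 1" by (intro add_mono uv')
    also have "(1 + 1 :: ennreal) = ennreal 2" using ennreal_plus[of 1 1] by simp
    finally show "(\<integral>\<^sup>+x. ennreal (enn2real (G x) powr r) \<partial>lebesgue) \<le> ennreal (H powr r) * ennreal 2"
      by (simp add: mult_left_mono)
  qed simp
  also have "\<dots> = ennreal (c powr (- r) * (H powr r * 2))"
    by (simp add: ennreal_mult)
  also have "\<dots> \<le> 1"
  proof -
    have "2 powr 1 \<le> (2::real) powr r" using r by (intro powr_mono) auto
    then have "H powr r * 2 \<le> H powr r * 2 powr r" by (intro mult_left_mono) auto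
    also have "\<dots> = (2 * H) powr r" using H by (simp add: powr_mult)
    also have "\<dots> \<le> c powr r" using c H r by (intro powr_mono2) auto
    finally have "c powr (- r) * (H powr r * 2) \<le> c powr (- r) * c powr r"
      by (intro mult_left_mono) auto
    also have "\<dots> = 1" using c by (simp flip: powr_add)
    finally show ?thesis by simp
  qed
  finally show ?thesis by (simp add: c_def)
qed

text \<open>
  Holds without side conditions because of the junk values \<open>enn2real \<infinity> = 0\<close> and \<open>x / 0 = 0\<close>.
\<close>
lemma enn2real_divide: "enn2real (a / b) = enn2real a / enn2real b"
proof -
  have "enn2real (inverse b) = inverse (enn2real b)"
  proof (cases b)
    case (real c)
    then show ?thesis by (cases "c = 0") (auto simp: inverse_ennreal)
  qed simp
  then show ?thesis
    by (simp add: divide_ennreal_def divide_inverse enn2real_mult)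
qed

text \<open>The bounds \<open>a\<close> and \<open>b\<close> are kept general so that one estimate
  serves both \<open>p\<close> with its essential bounds and the constant exponent \<nu> with a = b
  = \<nu>.\<close>

lemma conv_bound:
  fixes u v :: "'a::euclidean_space \<Rightarrow> 'k::{real_normed_field, banach, second_countable_topology}"
    and a b \<nu> :: ennreal
  defines "\<theta> \<equiv> \<lambda>t::real. if t \<le> 1 then enn2real (2 / a) * (1 - enn2real (\<nu> / (2 * b)))
      else enn2real (2 / b) * (1 - enn2real (\<nu> / (2 * a)))"
  assumes meas: "q \<in> borel_measurable lebesgue" "u \<in> borel_measurable lebesgue"
      "v \<in> borel_measurable lebesgue"
    and t: "0 < t" and m: "0 \<le> m"
    and q: "AE y in lebesgue. a \<le> q y \<and> q y \<le> b" and a2: "2 \<le> a"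
    and \<nu>: "2 \<le> \<nu>" "\<nu> \<le> 2 * a"
    and uv: "modular q u \<le> 1" "modular q v \<le> 1"
    and uv': "modular (\<lambda>_. \<nu>) u \<le> 1" "modular (\<lambda>_. \<nu>) v \<le> 1"
    and H: "0 < H" "\<And>x::'a. (\<integral>\<^sup>+y. ennreal (eta t m (x - y)) \<partial>lebesgue) \<le> ennreal H"
  shows "integrable lebesgue (\<lambda>y. eta t m (x - y) *\<^sub>R (u y * v y))"
    and "modular q (\<lambda>x. conv (eta t m) (\<lambda>y. u y * v y) x
      /\<^sub>R ((2 * H + 2) * t powr (- real DIM('a) * \<theta> t))) \<le> 1"
proof -
  define n where "n = real DIM('a)"
  \<comment> \<open>Since \<open>enn2real \<infinity> = 0\<close> and division by 0 gives 0,
    infinite bounds produce the intended values 2/\<infinity> = 0 and r/\<infinity> = 0.\<close>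
  define \<alpha> where "\<alpha> = enn2real a"
  define \<beta> where "\<beta> = enn2real b"
  define r where "r = enn2real \<nu> / 2"
  \<comment> \<open>T^(-q/2) \<le> t^n is hardest at the lower bound of q for t \<le> 1 and at the
    upper bound for t > 1; this fixes \<kappa>. Then T \<ge> 1 in the first case and T \<le> 1 in
    the second, so T^(1-r/q) is largest at the upper and at the lower bound, respectively; this
    fixes \<tau>.\<close>
  define \<kappa> where "\<kappa> = (if t \<le> 1 then 2 / \<alpha> else 2 / \<beta>)"
  define \<tau> where "\<tau> = (if t \<le> 1 then r / \<beta> else r / \<alpha>)"
  define T where "T = t powr (- n * \<kappa>)"
  define L where "L = t powr (- n * \<theta> t)"
  have \<theta>: "\<theta> t = \<kappa> * (1 - \<tau>)"
    by (simp add: \<theta>_def \<kappa>_def \<tau>_def \<alpha>_def \<beta>_def r_def enn2real_divide enn2real_mult)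
  have n: "0 < n" by (simp add: n_def)
  have T: "0 < T" and L: "0 < L" using t by (auto simp: T_def L_def)
  have LT: "L = T powr (1 - \<tau>)" by (simp add: L_def T_def \<theta> powr_powr mult.assoc)
  have nonneg: "0 \<le> \<alpha>" "0 \<le> \<beta>" "0 \<le> r" by (auto simp: \<alpha>_def \<beta>_def r_def)
  have T1: "1 \<le> T" if "t \<le> 1"
    using powr_mono'[of "- n * \<kappa>" 0 t] that t n nonneg by (simp add: T_def \<kappa>_def)
  have T2: "T \<le> 1" if "1 < t"
    using powr_mono[of "- n * \<kappa>" 0 t] that t n nonneg by (simp add: T_def \<kappa>_def)
  have infb: "\<beta> = 0" if "a \<le> z" "z \<le> b" "z = \<infinity>" for z
    using that by (simp add: \<beta>_def top_unique)
  have fin: "2 \<le> \<alpha>" "\<alpha> \<le> enn2real z" "\<beta> = 0 \<or> enn2real z \<le> \<beta>"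
    if "a \<le> z" "z \<le> b" "z \<noteq> \<infinity>" for z
  proof -
    show "2 \<le> \<alpha>" "\<alpha> \<le> enn2real z" "\<beta> = 0 \<or> enn2real z \<le> \<beta>"
      using that a2 unfolding \<alpha>_def \<beta>_def
      by (cases a; cases z; cases b; auto simp: top_unique simp flip: ennreal_numeral)+
  qed
  have cond1: "(z = \<infinity> \<longrightarrow> 1 \<le> T) \<and> (z \<noteq> \<infinity> \<longrightarrow> 2 \<le> z \<and> T powr (- (enn2real z / 2)) \<le> t powr n)"
    if z: "a \<le> z" "z \<le> b" for z
  proof (intro conjI impI)
    assume "z = \<infinity>"
    then show "1 \<le> T" using infb[OF z] T1 t by (cases "t \<le> 1") (auto simp: T_def \<kappa>_def)
  next
    show "2 \<le> z" using a2 z(1) by (rule order_trans)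
  next
    assume "z \<noteq> \<infinity>"
    note f = fin[OF z this]
    define Q where "Q = enn2real z"
    have "T powr (- (Q / 2)) = t powr (n * (\<kappa> * Q / 2))"
      by (simp add: T_def powr_powr mult.assoc)
    also have "\<dots> \<le> t powr n"
    proof (cases "t \<le> 1")
      case True
      have "1 \<le> \<kappa> * Q / 2" using f True by (simp add: \<kappa>_def Q_def)
      then show ?thesis using True t n by (intro powr_mono') auto
    next
      case False
      have "\<kappa> * Q / 2 \<le> 1" using f False nonneg by (auto simp: \<kappa>_def Q_def divide_le_eq_1)
      then show ?thesis using False t n by (intro powr_mono) auto
    qed
    finally show "T powr (- (enn2real z / 2)) \<le> t powr n" by (simp add: Q_def)
  qed
  have cond2: "(z = \<infinity> \<longrightarrow> T \<le> L) \<and> (z \<noteq> \<infinity> \<longrightarrow> r \<le> enn2real z \<and> T powr (1 - r / enn2real z) \<le> L)"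
    if z: "a \<le> z" "z \<le> b" for z
  proof (intro conjI impI)
    \<comment> \<open>Here \<beta> = 0. For t \<le> 1 this gives \<tau> = 0 and hence L = T; for t >
      1 it gives \<kappa> = 0, and both are 1.\<close>
    assume "z = \<infinity>"
    then show "T \<le> L" using infb[OF z] T
      by (cases "t \<le> 1") (auto simp: T_def L_def \<theta> \<kappa>_def \<tau>_def)
  next
    assume zfin: "z \<noteq> \<infinity>"
    note f = fin[OF z this]
    have "r \<le> \<alpha>"
      using \<nu>(2) f(1) unfolding r_def \<alpha>_def
      by (cases a; cases \<nu>; auto simp flip: ennreal_numeral ennreal_mult)
    then show rz: "r \<le> enn2real z" using f by linarith
    define Q where "Q = enn2real z"
    show "T powr (1 - r / enn2real z) \<le> L"
    proof (cases "t \<le> 1")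
      case True
      have "\<tau> \<le> r / Q"
        using f True nonneg
        by (cases "\<beta> = 0") (auto simp: \<tau>_def Q_def intro!: divide_left_mono mult_pos_pos)
      then show ?thesis using T1 True unfolding LT Q_def by (intro powr_mono) auto
    next
      case False
      have "r / Q \<le> \<tau>"
        using f False nonneg by (auto simp: \<tau>_def Q_def intro!: divide_left_mono mult_pos_pos)
      then show ?thesis using T2 False T unfolding LT Q_def by (intro powr_mono') auto
    qed
  qed
  have q1: "AE y in lebesgue. (q y = \<infinity> \<longrightarrow> 1 \<le> T) \<and>
      (q y \<noteq> \<infinity> \<longrightarrow> 2 \<le> q y \<and> T powr (- (enn2real (q y) / 2)) \<le> t powr real DIM('a))"
    by (rule eventually_mono[OF q]) (use cond1[unfolded n_def] in blast)
  have q2: "AE y in lebesgue. (q y = \<infinity> \<longrightarrow> T \<le> L) \<and>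
      (q y \<noteq> \<infinity> \<longrightarrow> r \<le> enn2real (q y) \<and> T powr (1 - r / enn2real (q y)) \<le> L)"
    by (rule eventually_mono[OF q]) (use cond2 in blast)
  have sup: "(\<integral>\<^sup>+y. ennreal (eta t m (x - y) * (norm (u y) * norm (v y))) \<partial>lebesgue) \<le> ennreal (T * (H + 2))" for x
    using kernel_sup_bound[OF meas t T m q1 uv less_imp_le[OF H(1)] H(2)] .
  have sup': "(\<integral>\<^sup>+y. ennreal (eta t m (x - y) * (norm (u y) * norm (v y))) \<partial>lebesgue) < \<infinity>" for x
    using le_less_trans[OF sup ennreal_less_top] by simp
  show "integrable lebesgue (\<lambda>y. eta t m (x - y) *\<^sub>R (u y * v y))"
    by (rule norm_conv_le(1)[OF meas(2,3) t sup'])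
  show "modular q (\<lambda>x. conv (eta t m) (\<lambda>y. u y * v y) x
      /\<^sub>R ((2 * H + 2) * t powr (- real DIM('a) * \<theta> t))) \<le> 1"
  proof (cases "\<nu> = \<infinity>")
    case False
    then have r1: "1 \<le> r" "\<nu> = ennreal (2 * r)"
      using \<nu>(1) by (cases \<nu>; auto simp: r_def simp flip: ennreal_numeral)+
    show ?thesis
      using conv_modular_le_one[OF meas t T m L q1 q2 uv r1(1) uv'[unfolded r1(2)] H]
      by (simp add: L_def n_def)
  next
    \<comment> \<open>Now \<open>a\<close>, \<open>b\<close> and almost all values of
      \<open>q\<close> are infinite, and all powers of \<open>t\<close> have exponent 0. The
      supremum bound alone makes the modular vanish, without interpolation.\<close>
    case True
    then have a_inf: "a = \<infinity>" using \<nu>(2) by (cases a) (auto simp: top_unique simp flip: ennreal_numeral ennreal_mult)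
    have qi: "AE y in lebesgue. q y = \<infinity> \<and> b = \<infinity>"
      by (rule eventually_mono[OF q]) (auto simp: a_inf top_unique)
    then have b: "b = \<infinity>" using ex_of_AE_lebesgue by blast
    have \<kappa>0: "\<kappa> = 0" using b \<open>a = \<infinity>\<close> by (simp add: \<kappa>_def \<alpha>_def \<beta>_def)
    have T1': "T = 1" "t powr (- real DIM('a) * \<theta> t) = 1"
      using t by (auto simp: T_def \<theta> \<kappa>0)
    have "norm (conv (eta t m) (\<lambda>y. u y * v y) x) \<le> 2 * H + 2" for x
    proof -
      have "ennreal (norm (conv (eta t m) (\<lambda>y. u y * v y) x)) \<le> ennreal (T * (H + 2))"
        using norm_conv_le(2)[OF meas(2,3) t sup'] sup by (rule order_trans)
      then have "norm (conv (eta t m) (\<lambda>y. u y * v y) x) \<le> T * (H + 2)"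
        using H(1) T by (subst (asm) ennreal_le_iff) auto
      then show ?thesis using H(1) T1'(1) by simp
    qed
    then have g: "norm (conv (eta t m) (\<lambda>y. u y * v y) x /\<^sub>R (2 * H + 2)) \<le> 1" for x
      using H by (simp add: field_simps)
    have "AE x in lebesgue. omega_mod (q x) (norm (conv (eta t m) (\<lambda>y. u y * v y) x /\<^sub>R (2 * H + 2))) = 0"
      by (rule eventually_mono[OF qi]) (use g in \<open>simp add: omega_mod_def\<close>)
    from nn_integral_cong_AE[OF this] show ?thesis
      unfolding modular_def T1' by simp
  qed
qed

section \<open>From modulars of normalised functions to Luxemburg norms\<close>

lemma conv_scaleR:
  fixes u v :: "'a::euclidean_space \<Rightarrow> 'k::{real_normed_field, banach, second_countable_topology}"
  shows "conv g (\<lambda>y. (u y /\<^sub>R c) * (v y /\<^sub>R d)) x = conv g (\<lambda>y. u y * v y) x /\<^sub>R (c * d)"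
proof -
  have "g (x - y) *\<^sub>R ((u y /\<^sub>R c) * (v y /\<^sub>R d)) = (inverse (c * d)) *\<^sub>R (g (x - y) *\<^sub>R (u y * v y))" for y
    by (simp add: mult_ac)
  then show ?thesis by (simp only: conv_def integral_scaleR_right)
qed

text \<open>Take k = A + e and l = B + e and let e tend to 0 from above. The limit also covers A = 0
  or B = 0, where the product itself is not an admissible scale.\<close>

lemma Lp_norm_le_mult_of_modular:
  fixes F :: "'a::euclidean_space \<Rightarrow> 'k::real_normed_vector"
  assumes F: "F \<in> borel_measurable lebesgue" and D: "0 < D" and AB: "0 \<le> A" "0 \<le> B"
    and mod: "\<And>k l. A < k \<Longrightarrow> B < l \<Longrightarrow> modular q (\<lambda>x. F x /\<^sub>R (D * k * l)) \<le> 1"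
  shows "F \<in> Lp_space q" "Lp_norm q F \<le> D * A * B"
proof -
  have pos: "0 < D * (A + e) * (B + e)" if "0 < e" for e
    using D AB that by (auto intro!: mult_pos_pos)
  show "F \<in> Lp_space q"
    by (rule Lp_spaceI[OF F pos[of 1] mod]) auto
  have "((\<lambda>e. D * (A + e) * (B + e)) \<longlongrightarrow> D * (A + 0) * (B + 0)) (at_right 0)"
    by (intro tendsto_intros)
  moreover have "eventually (\<lambda>e. Lp_norm q F \<le> D * (A + e) * (B + e)) (at_right 0)"
    using eventually_at_right_less[of 0]
    by eventually_elim (intro Lp_norm_le pos mod; simp)
  ultimately have "Lp_norm q F \<le> D * (A + 0) * (B + 0)"
    by (rule tendsto_lowerbound) simp
  then show "Lp_norm q F \<le> D * A * B" by simp
qed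

text \<open>Homogeneity reduces the claim to \<open>conv_bound\<close> for u/k and v/l.
  \<open>A\<close> and \<open>B\<close> stand for any thresholds above which the scaled modulars are
  at most 1: intersection norms in one application, multiples of variable exponent norms in the
  other.\<close>

lemma Lp_norm_conv_le:
  fixes u v :: "'a::euclidean_space \<Rightarrow> 'k::{real_normed_field, banach, second_countable_topology}"
    and a b \<nu> :: ennreal
  defines "\<theta> \<equiv> \<lambda>t::real. if t \<le> 1 then enn2real (2 / a) * (1 - enn2real (\<nu> / (2 * b)))
      else enn2real (2 / b) * (1 - enn2real (\<nu> / (2 * a)))"
  assumes meas: "q \<in> borel_measurable lebesgue" "u \<in> borel_measurable lebesgue"
      "v \<in> borel_measurable lebesgue"
    and t: "0 < t" and m: "0 \<le> m"
    and q: "AE y in lebesgue. a \<le> q y \<and> q y \<le> b" and a2: "2 \<le> a"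
    and \<nu>: "2 \<le> \<nu>" "\<nu> \<le> 2 * a"
    and AB: "0 \<le> A" "0 \<le> B"
    and u: "\<And>k. A < k \<Longrightarrow> modular q (\<lambda>x. u x /\<^sub>R k) \<le> 1 \<and> modular (\<lambda>_. \<nu>) (\<lambda>x. u x /\<^sub>R k) \<le> 1"
    and v: "\<And>k. B < k \<Longrightarrow> modular q (\<lambda>x. v x /\<^sub>R k) \<le> 1 \<and> modular (\<lambda>_. \<nu>) (\<lambda>x. v x /\<^sub>R k) \<le> 1"
    and H: "0 < H" "\<And>x::'a. (\<integral>\<^sup>+y. ennreal (eta t m (x - y)) \<partial>lebesgue) \<le> ennreal H"
  shows "conv_defined (eta t m) (\<lambda>y. u y * v y)" "conv (eta t m) (\<lambda>y. u y * v y) \<in> Lp_space q"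
    "Lp_norm q (conv (eta t m) (\<lambda>y. u y * v y))
      \<le> (2 * H + 2) * t powr (- real DIM('a) * \<theta> t) * A * B"
proof -
  note [measurable] = meas
  define D where "D = (2 * H + 2) * t powr (- real DIM('a) * \<theta> t)"
  have D: "0 < D" using H t by (simp add: D_def)
  have bound: "integrable lebesgue (\<lambda>y. eta t m (x - y) *\<^sub>R ((u y /\<^sub>R k) * (v y /\<^sub>R l)))"
    "modular q (\<lambda>x. conv (eta t m) (\<lambda>y. u y * v y) x /\<^sub>R (D * k * l)) \<le> 1"
    if k: "A < k" and l: "B < l" for k l x
  proof -
    have "(\<lambda>x. u x /\<^sub>R k) \<in> borel_measurable lebesgue" "(\<lambda>x. v x /\<^sub>R l) \<in> borel_measurable lebesgue"
      by measurable
    note cb = conv_bound[OF meas(1) this t m q a2 \<nu> conjunct1[OF u[OF k]] conjunct1[OF v[OF l]]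
        conjunct2[OF u[OF k]] conjunct2[OF v[OF l]] H]
    show "integrable lebesgue (\<lambda>y. eta t m (x - y) *\<^sub>R ((u y /\<^sub>R k) * (v y /\<^sub>R l)))"
      by (rule cb(1))
    have eq: "conv (eta t m) (\<lambda>y. (u y /\<^sub>R k) * (v y /\<^sub>R l)) x /\<^sub>R D
        = conv (eta t m) (\<lambda>y. u y * v y) x /\<^sub>R (D * k * l)" for x
      by (simp only: conv_scaleR scaleR_scaleR inverse_mult_distrib mult_ac)
    have "modular q (\<lambda>x. conv (eta t m) (\<lambda>y. (u y /\<^sub>R k) * (v y /\<^sub>R l)) x /\<^sub>R D) \<le> 1"
      using cb(2) unfolding D_def \<theta>_def .
    then show "modular q (\<lambda>x. conv (eta t m) (\<lambda>y. u y * v y) x /\<^sub>R (D * k * l)) \<le> 1"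
      by (simp only: eq)
  qed
  have "integrable lebesgue (\<lambda>y. eta t m (x - y) *\<^sub>R (u y * v y))" for x
  proof -
    have "integrable lebesgue (\<lambda>y. ((A + 1) * (B + 1)) *\<^sub>R
        (eta t m (x - y) *\<^sub>R ((u y /\<^sub>R (A + 1)) * (v y /\<^sub>R (B + 1)))))"
      by (intro integrable_scaleR_right bound(1)) auto
    moreover have "((A + 1) * (B + 1)) *\<^sub>R
        (eta t m (x - y) *\<^sub>R ((u y /\<^sub>R (A + 1)) * (v y /\<^sub>R (B + 1))))
        = eta t m (x - y) *\<^sub>R (u y * v y)" for y
    proof -
      have "a * (b * (inverse b * inverse a)) = 1" if "a \<noteq> 0" "b \<noteq> 0" for a b :: real
        using that by (simp add: field_simps)
      then show ?thesis using AB by simp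
    qed
    ultimately show ?thesis by (simp only:)
  qed
  then show "conv_defined (eta t m) (\<lambda>y. u y * v y)"
    by (simp add: conv_defined_def)
  have F: "conv (eta t m) (\<lambda>y. u y * v y) \<in> borel_measurable lebesgue"
    by (intro borel_measurable_conv) measurable
  show "conv (eta t m) (\<lambda>y. u y * v y) \<in> Lp_space q"
    by (rule Lp_norm_le_mult_of_modular(1)[OF F D AB bound(2)])
  show "Lp_norm q (conv (eta t m) (\<lambda>y. u y * v y))
      \<le> (2 * H + 2) * t powr (- real DIM('a) * \<theta> t) * A * B"
    using Lp_norm_le_mult_of_modular(2)[OF F D AB bound(2)] by (simp add: D_def)
qed

section \<open>Log-Hoelder exponents\<close>

text \<open>The decay forces the constant chosen in \<open>log_hoelder\<close> to be the limit of
  1/p, so it can be replaced by the reciprocal of \<open>p_infty p\<close>.\<close>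

lemma log_exps_p_infty:
  fixes p :: "'a::euclidean_space \<Rightarrow> ennreal"
  assumes p: "p \<in> log_exps"
  shows "\<exists>c>0. \<forall>x. \<bar>enn2real (1 / p x) - enn2real (1 / p_infty p)\<bar> \<le> c / ln (exp 1 + norm x)"
proof -
  obtain c g where c: "0 < c" "\<And>x. \<bar>enn2real (1 / p x) - g\<bar> \<le> c / ln (exp 1 + norm x)"
    using p unfolding log_exps_def log_hoelder_def by blast
  have p1: "1 \<le> p x" for x using p by (auto simp: log_exps_def var_exps_def)
  have "filterlim (\<lambda>x::'a. exp 1 + norm x) at_top at_infinity"
    by (intro filterlim_tendsto_add_at_top[OF tendsto_const] filterlim_norm_at_top)
  then have "filterlim (\<lambda>x::'a. ln (exp 1 + norm x)) at_top at_infinity"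
    by (rule filterlim_compose[OF ln_at_top])
  then have "((\<lambda>x::'a. c / ln (exp 1 + norm x)) \<longlongrightarrow> 0) at_infinity"
    by (intro tendsto_divide_0[OF tendsto_const] filterlim_at_top_imp_at_infinity)
  then have "((\<lambda>x. enn2real (1 / p x) - g) \<longlongrightarrow> 0) at_infinity"
    by (rule Lim_null_comparison[rotated]) (use c in auto)
  then have lim: "((\<lambda>x. enn2real (1 / p x)) \<longlongrightarrow> g) at_infinity"
    by (rule LIM_zero_cancel)
  then have g: "0 \<le> g"
    by (rule tendsto_lowerbound) (auto simp: trivial_limit_at_infinity)
  \<comment> \<open>Finiteness of 1/p, a consequence of p \<ge> 1, allows the real limit to be
    transferred back to \<open_placeholder>\<close>
  have fin: "1 / p x \<noteq> \<infinity>" for x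
    using p1[of x] by (auto simp: ennreal_divide_eq_top_iff)
  have "((\<lambda>x. ennreal (enn2real (1 / p x))) \<longlongrightarrow> ennreal g) at_infinity"
    by (intro tendsto_ennrealI lim)
  then have "((\<lambda>x. 1 / p x) \<longlongrightarrow> ennreal g) at_infinity"
    using fin by (simp add: less_top)
  then have "Lim at_infinity (\<lambda>x. 1 / p x) = ennreal g"
    by (intro tendsto_Lim) (simp_all add: trivial_limit_at_infinity)
  then have "enn2real (1 / p_infty p) = g"
    using g by (simp add: p_infty_def enn2real_divide)
  then show ?thesis using c by blast
qed

text \<open>
  Where \<open>z\<^bsup>r\<^esup>\<close>, \<open>z = s / e\<^bsup>mc\<^esup>\<close>, exceeds the weight \<open>E\<^bsup>-m\<^esup>\<close>, the factor \<open>z\<^bsup>r-q\<^esup>\<close> is at most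
  \<open>E\<close> to the power \<open>mq (1/r - 1/q) \<le> mqc / ln E\<close>, that is, at most \<open>e\<^bsup>mcq\<^esup>\<close>.
\<close>
lemma powr_le_weight_or_omega_mod:
  assumes s: "0 \<le> s" and r: "0 < r" and m: "0 \<le> m" and E: "1 < E"
    and q: "ennreal r \<le> q" and c: "1 / r - enn2real (1 / q) \<le> c / ln E"
  shows "ennreal ((s / exp (m * c)) powr r) \<le> ennreal (E powr (- m)) + omega_mod q s"
proof -
  define z where "z = s / exp (m * c)"
  have z: "0 \<le> z" using s by (simp add: z_def)
  have lnE: "0 < ln E" using E by simp
  have "ennreal (z powr r) \<le> ennreal (E powr (- m)) \<or> ennreal (z powr r) \<le> omega_mod q s"
  proof (cases "q = \<infinity>")
    case True
    then have "ln E \<le> c * r" using c r lnE by (simp add: field_simps)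
    show ?thesis
    proof (cases "s \<le> 1")
      case True
      have "z powr r \<le> exp (- (m * c)) powr r"
        using True z r by (intro powr_mono2) (auto simp: z_def exp_minus field_simps)
      also have "\<dots> = exp (- m * (c * r))" by (simp add: powr_def)
      also have "\<dots> \<le> exp (- m * ln E)"
        using \<open>ln E \<le> c * r\<close> m by (simp add: mult_left_mono)
      also have "\<dots> = E powr (- m)" using E by (simp add: powr_def)
      finally show ?thesis by (simp add: ennreal_leI)
    qed (use \<open>q = \<infinity>\<close> in \<open>simp add: omega_mod_def\<close>)
  next
    case False
    define Q where "Q = enn2real q"
    have Q: "r \<le> Q" "0 < Q" using False q r by (cases q; auto simp: Q_def)+
    have cQ: "1 / r - 1 / Q \<le> c / ln E" using c by (simp add: Q_def enn2real_divide)
    show ?thesis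
    proof (cases "z powr r \<le> E powr (- m)")
      case big: False
      then have z0: "0 < z" using z by (cases "z = 0") auto
      have zm: "z powr (- r) \<le> E powr m"
        using big E z0 by (simp add: powr_minus field_simps)
      have "z powr (- (Q - r)) = (z powr (- r)) powr ((Q - r) / r)"
        using r by (simp add: powr_powr)
      also have "\<dots> \<le> (E powr m) powr ((Q - r) / r)"
        using zm Q r by (intro powr_mono2) auto
      also have "\<dots> = E powr (m * (Q * (1 / r - 1 / Q)))"
      proof -
        have "(Q - r) / r = Q * (1 / r - 1 / Q)" using Q r by (simp add: field_simps)
        then show ?thesis by (simp only: powr_powr)
      qed
      also have "\<dots> \<le> E powr (m * (Q * (c / ln E)))"
        using cQ m Q E by (intro powr_mono mult_left_mono) auto
      also have "\<dots> = exp (m * c) powr Q"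
        using E lnE by (simp add: powr_def)
      finally have "z powr Q * z powr (- (Q - r)) \<le> z powr Q * exp (m * c) powr Q"
        by (intro mult_left_mono) auto
      also have "z powr Q * z powr (- (Q - r)) = z powr r" by (simp flip: powr_add)
      also have "z powr Q * exp (m * c) powr Q = s powr Q"
        using s by (simp add: z_def flip: powr_mult)
      finally show ?thesis using False by (simp add: omega_mod_def Q_def ennreal_leI)
    qed (simp add: ennreal_leI)
  qed
  then show ?thesis
    unfolding z_def[symmetric] by (auto intro: order_trans add_increasing add_increasing2)
qed

lemma Lp_embedding_p_minus:
  fixes p :: "'a::euclidean_space \<Rightarrow> ennreal"
  assumes p: "p \<in> log_exps" "p_minus p = p_infty p" and p2: "2 \<le> p_minus p"
    and m: "real DIM('a) < m"
  obtains K where "1 \<le> K" "\<And>u :: 'a \<Rightarrow> 'k::{real_normed_vector, second_countable_topology}.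
    u \<in> borel_measurable lebesgue \<Longrightarrow> modular p u \<le> 1 \<Longrightarrow> modular (\<lambda>_. p_minus p) (\<lambda>x. u x /\<^sub>R K) \<le> 1"
proof (cases "p_minus p = \<infinity>")
  case True
  have ae: "AE x in lebesgue. p_minus p = p x"
    using AE_p_minus_le[of p] by (auto elim!: eventually_mono simp: True top_unique)
  show ?thesis
    by (rule that[of 1]) (simp_all add: modular_cong_AE[OF ae])
next
  case False
  have [measurable]: "p \<in> borel_measurable lebesgue"
    using p by (simp add: log_exps_def var_exps_def)
  obtain H where H: "1 \<le> H" "\<And>t (x::'a). 0 < t \<Longrightarrow>
      (\<integral>\<^sup>+y. ennreal (eta t m (x - y)) \<partial>lebesgue) \<le> ennreal H"
    using eta_integral_bound[OF m] by blast
  obtain c where c: "0 < c" "\<And>x. \<bar>enn2real (1 / p x) - enn2real (1 / p_infty p)\<bar> \<le> c / ln (exp 1 + norm x)"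
    using log_exps_p_infty[OF p(1)] by blast
  have m0: "0 \<le> m" using m by linarith
  define r where "r = enn2real (p_minus p)"
  have r: "p_minus p = ennreal r" "2 \<le> r"
    using False p2 by (cases "p_minus p"; auto simp: r_def simp flip: ennreal_numeral)+
  have r_inf: "enn2real (1 / p_infty p) = 1 / r"
    by (simp add: r_def enn2real_divide flip: p(2))
  define K where "K = exp (m * c) * (H + 1)"
  have K1: "1 \<le> K"
    unfolding K_def using m0 c(1) H(1) mult_mono[of 1 "exp (m * c)" 1 "H + 1"] by simp
  have "modular (\<lambda>_. p_minus p) (\<lambda>x. u x /\<^sub>R K) \<le> 1"
    if [measurable]: "u \<in> borel_measurable lebesgue" and u: "modular p u \<le> 1" for u :: "'a \<Rightarrow> 'k"
  proof -
    note [measurable] = borel_measurable_eta_section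
    let ?h = "inverse (H + 1)"
    have "modular (\<lambda>_. p_minus p) (\<lambda>x. u x /\<^sub>R K)
        \<le> (\<integral>\<^sup>+x. ennreal ?h * (ennreal (eta 1 m (0 - x)) + omega_mod (p x) (norm (u x))) \<partial>lebesgue)"
      unfolding modular_def
    proof (rule nn_integral_mono_AE, use AE_p_minus_le[of p] in eventually_elim)
      case (elim x)
      define z where "z = norm (u x) / exp (m * c)"
      have "ennreal (z powr r) \<le> ennreal ((exp 1 + norm x) powr (- m)) + omega_mod (p x) (norm (u x))"
        unfolding z_def
      proof (rule powr_le_weight_or_omega_mod)
        show "1 < exp 1 + norm x" 
          using exp_ge_add_one_self[of 1] norm_ge_zero[of x] by linarith
        show "1 / r - enn2real (1 / p x) \<le> c / ln (exp 1 + norm x)"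
          using c(2)[of x] unfolding r_inf by linarith
      qed (use elim r m0 in auto)
      also have "(exp 1 + norm x) powr (- m) \<le> eta 1 m (0 - x)"
        using m0 by (simp add: eta_def) (intro powr_mono2', auto intro: add_pos_nonneg)
      finally have z: "ennreal (z powr r) \<le> ennreal (eta 1 m (0 - x)) + omega_mod (p x) (norm (u x))"
        by (simp add: ennreal_leI add_right_mono)
      have "?h powr r \<le> ?h powr 1"
        using H(1) r by (intro powr_mono') (auto simp: inverse_le_1_iff)
      then have "?h powr r * z powr r \<le> ?h * z powr r"
        using H(1) by (intro mult_right_mono) auto
      moreover have "(?h * z) powr r = ?h powr r * z powr r"
        using H(1) by (simp add: powr_mult z_def del: times_divide_eq_right)
      ultimately have "(?h * z) powr r \<le> ?h * z powr r" by simp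
      then have "ennreal ((?h * z) powr r) \<le> ennreal ?h * ennreal (z powr r)"
        using H(1) by (simp add: ennreal_leI flip: ennreal_mult)
      also have "\<dots> \<le> ennreal ?h * (ennreal (eta 1 m (0 - x)) + omega_mod (p x) (norm (u x)))"
        by (intro mult_left_mono z) auto
      also have "?h * z = norm (u x /\<^sub>R K)"
        using H(1) by (simp add: z_def K_def field_simps)
      finally show ?case using r by (simp add: omega_mod_def)
    qed
    also have "\<dots> = ennreal ?h * ((\<integral>\<^sup>+x. ennreal (eta 1 m (0 - x :: 'a)) \<partial>lebesgue) + modular p u)"
      by (simp add: nn_integral_cmult nn_integral_add modular_def del: diff_0)
    also have "\<dots> \<le> ennreal ?h * (ennreal H + 1)"
      by (intro mult_left_mono add_mono H u) auto
    also have "ennreal H + 1 = ennreal (H + 1)"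
      using H(1) by simp
    also have "ennreal ?h * \<dots> = ennreal (?h * (H + 1))"
      using H(1) by (intro ennreal_mult[symmetric]) auto
    also have "\<dots> = 1" using H(1) by simp
    finally show ?thesis .
  qed
  with K1 show ?thesis by (rule that)
qed

section \<open>The product estimates\<close>

theorem lemma3p11:
  fixes p :: "real ^ 'n \<Rightarrow> ennreal" and m :: real
  assumes "p \<in> var_exps"
    and "2 \<le> p_minus p"
    and "real CARD('n) < m"
  shows
    "(\<exists>C>0. \<forall>\<nu>::ennreal. 2 \<le> \<nu> \<and> \<nu> \<le> 2 * p_minus p \<longrightarrow>
       (\<forall>t>0. \<forall>u v :: real ^ 'n \<Rightarrow> 'k::{real_normed_field, banach, second_countable_topology}.
          u \<in> Lp_space p \<inter> Lp_space (\<lambda>_. \<nu>) \<longrightarrow> v \<in> Lp_space p \<inter> Lp_space (\<lambda>_. \<nu>) \<longrightarrow>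
          conv_defined (eta t m) (\<lambda>x. u x * v x) \<and>
          conv (eta t m) (\<lambda>x. u x * v x) \<in> Lp_space p \<inter> Lp_space (\<lambda>_. \<nu>) \<and>
          Lp_inter_norm p (\<lambda>_. \<nu>) (conv (eta t m) (\<lambda>x. u x * v x))
            \<le> C * max (t powr (- real CARD('n) * omega_exp p \<nu> t))
                      (t powr (- enn2real (of_nat CARD('n) / \<nu>)))
                * Lp_inter_norm p (\<lambda>_. \<nu>) u * Lp_inter_norm p (\<lambda>_. \<nu>) v)) \<and>
     (p \<in> log_exps \<and> p_minus p = p_infty p \<longrightarrow>
       (\<exists>C>0. \<forall>t>0. \<forall>u v :: real ^ 'n \<Rightarrow> 'k.
          u \<in> Lp_space p \<longrightarrow> v \<in> Lp_space p \<longrightarrow>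
          conv_defined (eta t m) (\<lambda>x. u x * v x) \<and>
          conv (eta t m) (\<lambda>x. u x * v x) \<in> Lp_space p \<and>
          Lp_norm p (conv (eta t m) (\<lambda>x. u x * v x))
            \<le> C * t powr (- real CARD('n) * phi_exp p t) * Lp_norm p u * Lp_norm p v))"
proof -
  have p_meas: "p \<in> borel_measurable lebesgue" and p1: "1 \<le> p x" for x
    using assms(1) by (auto simp: var_exps_def)
  have m: "real DIM(real ^ 'n) < m" "0 \<le> m" using assms(3) by auto
  obtain H where H1: "1 \<le> H" and H: "\<And>t (x :: real ^ 'n). 0 < t \<Longrightarrow>
      (\<integral>\<^sup>+y. ennreal (eta t m (x - y)) \<partial>lebesgue) \<le> ennreal H"
    using eta_integral_bound[OF m(1)] by blast
  define C where "C = 2 * H + 2"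
  have C: "0 < C" "0 < H" using H1 by (auto simp: C_def)
  have pb: "AE x in lebesgue. p_minus p \<le> p x \<and> p x \<le> p_plus p"
    using AE_p_minus_le[of p] AE_le_p_plus[OF p_meas] by eventually_elim simp
  have p_pm: "p_minus p \<le> p_plus p"
    using ex_of_AE_lebesgue[OF pb] by (blast intro: order_trans)
  show ?thesis
  proof (intro conjI impI)
    have "conv_defined (eta t m) (\<lambda>x. u x * v x) \<and>
          conv (eta t m) (\<lambda>x. u x * v x) \<in> Lp_space p \<inter> Lp_space (\<lambda>_. \<nu>) \<and>
          Lp_inter_norm p (\<lambda>_. \<nu>) (conv (eta t m) (\<lambda>x. u x * v x))
            \<le> C * max (t powr (- real CARD('n) * omega_exp p \<nu> t))
                      (t powr (- enn2real (of_nat CARD('n) / \<nu>)))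
                * Lp_inter_norm p (\<lambda>_. \<nu>) u * Lp_inter_norm p (\<lambda>_. \<nu>) v"
      if \<nu>: "2 \<le> \<nu>" "\<nu> \<le> 2 * p_minus p" and t: "0 < t"
        and u: "u \<in> Lp_space p" "u \<in> Lp_space (\<lambda>_. \<nu>)" and v: "v \<in> Lp_space p" "v \<in> Lp_space (\<lambda>_. \<nu>)"
      for \<nu> :: ennreal and t and u v :: "real ^ 'n \<Rightarrow> 'k"
    proof -
      let ?F = "conv (eta t m) (\<lambda>x. u x * v x)"
      let ?A = "Lp_inter_norm p (\<lambda>_. \<nu>) u" and ?B = "Lp_inter_norm p (\<lambda>_. \<nu>) v"
      let ?X = "t powr (- real CARD('n) * omega_exp p \<nu> t)"
      let ?Y = "t powr (- enn2real (of_nat CARD('n) / \<nu>))"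
      have \<nu>1: "1 \<le> \<nu>" using \<nu>(1) by (rule order_trans[rotated]) simp
      have meas: "u \<in> borel_measurable lebesgue" "v \<in> borel_measurable lebesgue"
        using u v by (auto simp: Lp_space_def)
      have nonneg: "0 \<le> ?A" "0 \<le> ?B"
        using Lp_norm_nonneg[OF p_meas p1 u(1)] Lp_norm_nonneg[OF p_meas p1 v(1)]
        by (auto simp: Lp_inter_norm_def)
      have scaled: "modular p (\<lambda>x. w x /\<^sub>R k) \<le> 1 \<and> modular (\<lambda>_. \<nu>) (\<lambda>x. w x /\<^sub>R k) \<le> 1"
        if "w \<in> Lp_space p" "w \<in> Lp_space (\<lambda>_. \<nu>)" "Lp_inter_norm p (\<lambda>_. \<nu>) w < k"
        for w :: "real ^ 'n \<Rightarrow> 'k" and k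
        using that modular_le_one_of_Lp_norm_less(2)[OF p_meas p1 that(1), of k]
          modular_le_one_of_Lp_norm_less(2)[OF borel_measurable_const \<nu>1 that(2), of k]
        by (simp add: Lp_inter_norm_def)
      note su = scaled[OF u] and sv = scaled[OF v]
      note P = Lp_norm_conv_le[OF p_meas meas t m(2) pb assms(2) \<nu> nonneg su sv C(2) H[OF t],
          folded omega_exp_def[of p \<nu> t] C_def]
      have \<nu>b: "AE x in (lebesgue :: (real ^ 'n) measure). \<nu> \<le> \<nu> \<and> \<nu> \<le> \<nu>" by simp
      have \<nu>\<nu>: "\<nu> \<le> 2 * \<nu>" by (simp add: mult_2)
      note N = Lp_norm_conv_le[OF borel_measurable_const meas t m(2) \<nu>b \<nu>(1) \<nu>(1) \<nu>\<nu> nonneg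
          conjI[OF conjunct2[OF su] conjunct2[OF su]] conjI[OF conjunct2[OF sv] conjunct2[OF sv]] C(2) H[OF t], folded C_def]
      have \<nu>_exp: "enn2real (2 / \<nu>) * (1 - enn2real (\<nu> / (2 * \<nu>))) = 1 / enn2real \<nu>"
        by (cases "enn2real \<nu> = 0") (auto simp: enn2real_divide enn2real_mult)
      have "Lp_norm p ?F \<le> C * max ?X ?Y * ?A * ?B"
      proof (rule order_trans)
        show "Lp_norm p ?F \<le> C * ?X * ?A * ?B" using P(3) by simp
        show "C * ?X * ?A * ?B \<le> C * max ?X ?Y * ?A * ?B"
          using nonneg C by (intro mult_right_mono mult_left_mono) auto
      qed
      moreover have "Lp_norm (\<lambda>_. \<nu>) ?F \<le> C * max ?X ?Y * ?A * ?B"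
      proof (rule order_trans)
        show "Lp_norm (\<lambda>_. \<nu>) ?F \<le> C * ?Y * ?A * ?B"
          using N(3) by (simp only: \<nu>_exp if_cancel) (simp add: enn2real_divide)
        show "C * ?Y * ?A * ?B \<le> C * max ?X ?Y * ?A * ?B"
          using nonneg C by (intro mult_right_mono mult_left_mono) auto
      qed
      ultimately show ?thesis
        using P(1,2) N(2) by (simp add: Lp_inter_norm_def[of p "\<lambda>_. \<nu>" ?F])
    qed
    then show "\<exists>C>0. \<forall>\<nu>::ennreal. 2 \<le> \<nu> \<and> \<nu> \<le> 2 * p_minus p \<longrightarrow>
       (\<forall>t>0. \<forall>u v :: real ^ 'n \<Rightarrow> 'k.
          u \<in> Lp_space p \<inter> Lp_space (\<lambda>_. \<nu>) \<longrightarrow> v \<in> Lp_space p \<inter> Lp_space (\<lambda>_. \<nu>) \<longrightarrow>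
          conv_defined (eta t m) (\<lambda>x. u x * v x) \<and>
          conv (eta t m) (\<lambda>x. u x * v x) \<in> Lp_space p \<inter> Lp_space (\<lambda>_. \<nu>) \<and>
          Lp_inter_norm p (\<lambda>_. \<nu>) (conv (eta t m) (\<lambda>x. u x * v x))
            \<le> C * max (t powr (- real CARD('n) * omega_exp p \<nu> t))
                      (t powr (- enn2real (of_nat CARD('n) / \<nu>)))
                * Lp_inter_norm p (\<lambda>_. \<nu>) u * Lp_inter_norm p (\<lambda>_. \<nu>) v)"
      using C(1) by (intro exI[of _ C]) blast
  next
    assume p: "p \<in> log_exps \<and> p_minus p = p_infty p"
    obtain K where K: "1 \<le> K" "\<And>w :: real ^ 'n \<Rightarrow> 'k. w \<in> borel_measurable lebesgue \<Longrightarrow>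
        modular p w \<le> 1 \<Longrightarrow> modular (\<lambda>_. p_minus p) (\<lambda>x. w x /\<^sub>R K) \<le> 1"
      using Lp_embedding_p_minus[OF conjunct1[OF p] conjunct2[OF p] assms(2) m(1)] by blast
    have "conv_defined (eta t m) (\<lambda>x. u x * v x) \<and>
          conv (eta t m) (\<lambda>x. u x * v x) \<in> Lp_space p \<and>
          Lp_norm p (conv (eta t m) (\<lambda>x. u x * v x))
            \<le> C * K\<^sup>2 * t powr (- real CARD('n) * phi_exp p t) * Lp_norm p u * Lp_norm p v"
      if t: "0 < t" and u: "u \<in> Lp_space p" and v: "v \<in> Lp_space p"
      for t and u v :: "real ^ 'n \<Rightarrow> 'k"
    proof -
      have meas: "u \<in> borel_measurable lebesgue" "v \<in> borel_measurable lebesgue"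
        using u v by (auto simp: Lp_space_def)
      have nonneg: "0 \<le> K * Lp_norm p w" if "w \<in> Lp_space p" for w :: "real ^ 'n \<Rightarrow> 'k"
        using K(1) Lp_norm_nonneg[OF p_meas p1 that] by simp
      have scaled: "modular p (\<lambda>x. w x /\<^sub>R k) \<le> 1 \<and> modular (\<lambda>_. p_minus p) (\<lambda>x. w x /\<^sub>R k) \<le> 1"
        if w: "w \<in> Lp_space p" and k: "K * Lp_norm p w < k" for w :: "real ^ 'n \<Rightarrow> 'k" and k
      proof
        have [measurable]: "w \<in> borel_measurable lebesgue" using w by (simp add: Lp_space_def)
        have "1 * Lp_norm p w \<le> K * Lp_norm p w"
          using K(1) Lp_norm_nonneg[OF p_meas p1 w] by (intro mult_right_mono) auto
        then show "modular p (\<lambda>x. w x /\<^sub>R k) \<le> 1"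
          using k by (intro modular_le_one_of_Lp_norm_less(2)[OF p_meas p1 w]) simp
        have "Lp_norm p w < k / K" using k K(1) by (simp add: field_simps)
        then have "modular p (\<lambda>x. w x /\<^sub>R (k / K)) \<le> 1"
          by (rule modular_le_one_of_Lp_norm_less(2)[OF p_meas p1 w])
        from K(2)[OF _ this] have "modular (\<lambda>_. p_minus p) (\<lambda>x. (w x /\<^sub>R (k / K)) /\<^sub>R K) \<le> 1"
          by simp
        moreover have "(w x /\<^sub>R (k / K)) /\<^sub>R K = w x /\<^sub>R k" for x
          using K(1) by (simp add: inverse_eq_divide)
        ultimately show "modular (\<lambda>_. p_minus p) (\<lambda>x. w x /\<^sub>R k) \<le> 1"
          by (simp only:)
      qed
      have le2: "p_minus p \<le> 2 * p_minus p" by (simp add: mult_2)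
      note P = Lp_norm_conv_le[OF p_meas meas t m(2) pb assms(2) assms(2) le2 nonneg[OF u] nonneg[OF v]
          scaled[OF u] scaled[OF v] C(2) H[OF t], folded omega_exp_def[of p "p_minus p" t] C_def]
      have "omega_exp p (p_minus p) t = phi_exp p t"
      proof (cases "p_minus p = \<infinity>")
        case True
        then have "p_plus p = \<infinity>" using p_pm by (simp add: top_unique)
        then show ?thesis using True by (simp add: omega_exp_def phi_exp_def)
      next
        case False
        then have "0 < enn2real (p_minus p)"
          using assms(2) by (cases "p_minus p") (auto simp flip: ennreal_numeral)
        then show ?thesis
          by (simp add: omega_exp_def phi_exp_def enn2real_divide enn2real_mult field_simps)
      qed
      then show ?thesis
        using P by (simp add: power2_eq_square mult_ac)
    qed
    moreover have "0 < C * K\<^sup>2" using C K(1) by simp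
    ultimately show "\<exists>C>0. \<forall>t>0. \<forall>u v :: real ^ 'n \<Rightarrow> 'k.
          u \<in> Lp_space p \<longrightarrow> v \<in> Lp_space p \<longrightarrow>
          conv_defined (eta t m) (\<lambda>x. u x * v x) \<and>
          conv (eta t m) (\<lambda>x. u x * v x) \<in> Lp_space p \<and>
          Lp_norm p (conv (eta t m) (\<lambda>x. u x * v x))
            \<le> C * t powr (- real CARD('n) * phi_exp p t) * Lp_norm p u * Lp_norm p v"
      by (intro exI[of _ "C * K\<^sup>2"]) blast
  qed
qed

end
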